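(* For any non-empty indices $\mathbf{k}=(k_1,\dots,k_r)$ and $\mathbf{l}=(l_1,\dots,l_s)$, \[\zeta\bigl(\mu(\mathbf{k},\mathbf{l})\bigr)=\zeta\bigl(\mathbf{k}\circledast\mathbf{l}^\star\bigr).\]
   Context: Let $\mathfrak{H}=\mathbb{Q}\langle e_0,e_1\rangle$ be the noncommutative polynomial algebra over $\mathbb{Q}$ in two indeterminates, $\mathfrak{H}^1=\mathbb{Q}+e_1\mathfrak{H}$ and $\mathfrak{H}^0=\mathbb{Q}+e_1\mathfrak{H}e_0$. For an integer $k\ge 1$ put $e_k=e_1e_0^{k-1}$. An index is a finite (possibly empty) sequence $\mathbf{k}=(k_1,\dots,k_r)$ of positive integers ($r$ = depth, $k_1+\dots+k_r$ = weight); it is admissible if it is empty or $k_r\ge 2$. Indices are identified with the words $e_{k_1}\cdots e_{k_r}$ (the empty index $\varnothing$ with $1$); these form a basis of $\mathfrak{H}^1$, and those of admissible indices a basis of $\mathfrak{H}^0$; maps defined on indices are extended $\mathbb{Q}$-linearly. For admissible $\mathbf{k}$, $\zeta(\mathbf{k})=\sum_{0<m_1<\cdots<m_r}m_1^{-k_1}\cdots m_r^{-k_r}$, $\zeta(\varnothing)=1$, extended linearly to $\zeta:\mathfrak{H}^0\to\mathbb{R}$. Harmonic product: the $\mathbb{Q}$-bilinear product $*$ on $\mathfrak{H}^1$ with $1*w=w*1=w$ and $e_kv*e_lw=e_k(v*e_lw)+e_l(e_kv*w)+e_{k+l}(v*w)$ for $k,l\ge1$, $v,w\in\mathfrak{H}^1$.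 Circled harmonic product: the $\mathbb{Q}$-bilinear map $\circledast:e_1\mathfrak{H}\times e_1\mathfrak{H}\to e_1\mathfrak{H}e_0$ with $ve_k\circledast we_l=(v*w)e_{k+l}$ for $v,w\in\mathfrak{H}^1$, $k,l\ge1$. For non-empty $\mathbf{l}=(l_1,\dots,l_s)$, $\mathbf{l}^\star\in\mathfrak{H}^1$ is the sum of the $2^{s-1}$ indices $(l_1\bigcirc l_2\bigcirc\cdots\bigcirc l_s)$ where each $\bigcirc$ is either a comma or a plus sign. (Equivalently, $\zeta(\mathbf{k}\circledast\mathbf{l}^\star)=\sum_{0<m_1<\cdots<m_r=n_s\ge\cdots\ge n_1>0}m_1^{-k_1}\cdots m_r^{-k_r}n_1^{-l_1}\cdots n_s^{-l_s}$.) A 2-poset is a finite poset $X$ with a label map $\delta_X:X\to\{0,1\}$. Its word $W(X)\in\mathfrak{H}$ is the sum, over all linear extensions of the order (enumerations $x_1,\dots,x_n$ of $X$ such that $x_i<x_j$ in $X$ implies $i<j$), of $e_{\delta_X(x_1)}e_{\delta_X(x_2)}\cdots e_{\delta_X(x_n)}$; $W(\emptyset)=1$. Definition of $\mu(\mathbf{k},\mathbf{l})$: let $K=k_1+\dots+k_r$. Take elements $a_1,\dots,a_K$ and $b_{j,i}$ ($1\le j\le s$, $1\le i\le l_j$), with the partial order generated by $a_1<a_2<\cdots<a_K$, $a_K<b_{s,1}$, $b_{j,1}<b_{j,2}<\cdots<b_{j,l_j}$ for each $j$, and $b_{j-1,1}<b_{j,l_j}$ for $2\le j\le s$. Labels: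 $\delta(a_t)=1$ iff $t\in\{1,k_1+1,k_1+k_2+1,\dots,k_1+\dots+k_{r-1}+1\}$, else $0$; $\delta(b_{s,1})=0$; $\delta(b_{j,1})=1$ for $j<s$; $\delta(b_{j,i})=0$ for $i\ge2$. Then $\mu(\mathbf{k},\mathbf{l})\in\mathfrak{H}^0$ is $W$ of this 2-poset. *)

theory Defs
  imports "HOL-Analysis.Analysis" "HOL-Library.Poly_Mapping"
begin

section \<open>The algebra \<open>\<rat>\<langle>e\<^sub>0, e\<^sub>1\<rangle>\<close>\<close>

text \<open>
  Words in two letters form the free monoid, written additively so that the convolution product
  of \<^typ>\<open>'a \<Rightarrow>\<^sub>0 'b\<close> turns finitely supported functions on words into the free
  (noncommutative) algebra.
\<close>

datatype letter = L0 | L1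

datatype fword = Word (letters: "letter list")

instantiation fword :: monoid_add
begin

definition zero_fword :: fword where "zero_fword = Word []"

definition plus_fword :: "fword \<Rightarrow> fword \<Rightarrow> fword"
  where "plus_fword u v = Word (letters u @ letters v)"

instance
  by standard (simp_all add: zero_fword_def plus_fword_def)

end

type_synonym H = "fword \<Rightarrow>\<^sub>0 rat"

definition scal :: "rat \<Rightarrow> H"
  where "scal c = Poly_Mapping.single 0 c"

definition gen :: "letter \<Rightarrow> H"
  where "gen a = Poly_Mapping.single (Word [a]) 1"

abbreviation e0 :: H where "e0 \<equiv> gen L0"

abbreviation e1 :: H where "e1 \<equiv> gen L1"

definition H1 :: "H set"
  where "H1 = {scal c + e1 * p | c p. True}"

definition H0 :: "H set"
  where "H0 = {scal c + e1 * p * e0 | c p. True}"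

definition ek :: "nat \<Rightarrow> H"
  where "ek k = e1 * e0 ^ (k - 1)"


section \<open>Indices\<close>

definition is_index :: "nat list \<Rightarrow> bool"
  where "is_index ks \<longleftrightarrow> (\<forall>k\<in>set ks. 1 \<le> k)"

definition admissible :: "nat list \<Rightarrow> bool"
  where "admissible ks \<longleftrightarrow> is_index ks \<and> (ks = [] \<or> 2 \<le> last ks)"

definition idx :: "nat list \<Rightarrow> H"
  where "idx ks = prod_list (map ek ks)"

text \<open>The index identified with a given word; meaningful only for words lying in \<^const>\<open>H1\<close>.\<close>

definition index_of :: "fword \<Rightarrow> nat list"
  where "index_of w = (THE ks. is_index ks \<and> idx ks = Poly_Mapping.single w 1)"

text \<open>\<open>\<rat>\<close>-linear extension to \<^const>\<open>H1\<close> of a map given on indices.\<close>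

definition lin_ext :: "(nat list \<Rightarrow> H) \<Rightarrow> H \<Rightarrow> H"
  where "lin_ext f p =
    (\<Sum>w\<in>Poly_Mapping.keys p. scal (Poly_Mapping.lookup p w) * f (index_of w))"


section \<open>Multiple zeta values\<close>

text \<open>The series converges absolutely for admissible indices; for the empty index it is 1.\<close>

definition zeta_index :: "nat list \<Rightarrow> real"
  where "zeta_index ks =
    (\<Sum>\<^sub>\<infinity>ms\<in>{ms :: nat list. length ms = length ks \<and> sorted_wrt (<) ms \<and> (\<forall>m\<in>set ms. 0 < m)}.
       \<Prod>i<length ks. 1 / real (ms ! i) ^ (ks ! i))"

text \<open>Meaningful only on \<^const>\<open>H0\<close>.\<close>

definition zeta :: "H \<Rightarrow> real"
  where "zeta p =
    (\<Sum>w\<in>Poly_Mapping.keys p. of_rat (Poly_Mapping.lookup p w) * zeta_index (index_of w))"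


section \<open>Harmonic products\<close>

fun harm_index :: "nat list \<Rightarrow> nat list \<Rightarrow> H"
  where
    "harm_index [] ls = idx ls"
  | "harm_index (k # ks) [] = idx (k # ks)"
  | "harm_index (k # ks) (l # ls) =
       ek k * harm_index ks (l # ls) + ek l * harm_index (k # ks) ls + ek (k + l) * harm_index ks ls"

definition harm :: "H \<Rightarrow> H \<Rightarrow> H"
  where "harm p q = lin_ext (\<lambda>ks. lin_ext (\<lambda>ls. harm_index ks ls) q) p"

definition circ_harm_index :: "nat list \<Rightarrow> nat list \<Rightarrow> H"
  where "circ_harm_index ks ls =
    harm (idx (butlast ks)) (idx (butlast ls)) * ek (last ks + last ls)"

definition circ_harm :: "H \<Rightarrow> H \<Rightarrow> H"
  where "circ_harm p q = lin_ext (\<lambda>ks. lin_ext (\<lambda>ls. circ_harm_index ks ls) q) p"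

datatype separator = Comma | Plus

fun fill :: "nat list \<Rightarrow> separator list \<Rightarrow> nat list"
  where
    "fill (l # m # ls) (Comma # cs) = l # fill (m # ls) cs"
  | "fill (l # m # ls) (Plus # cs) = fill ((l + m) # ls) cs"
  | "fill ls _ = ls"

definition star :: "nat list \<Rightarrow> H"
  where "star ls = (\<Sum>cs | length cs = length ls - 1. idx (fill ls cs))"


section \<open>2-posets\<close>

definition two_poset :: "'a set \<Rightarrow> 'a rel \<Rightarrow> bool"
  where "two_poset X r \<longleftrightarrow> finite X \<and> r \<subseteq> X \<times> X \<and> partial_order_on X r"

definition linear_extensions :: "'a set \<Rightarrow> 'a rel \<Rightarrow> 'a list set"
  where "linear_extensions X r =
    {xs. distinct xs \<and> set xs = X \<and>
         (\<forall>i<length xs. \<forall>j<length xs. (xs ! i, xs ! j) \<in> r \<and> xs ! i \<noteq> xs ! j \<longrightarrow> i < j)}"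

definition poset_word :: "'a set \<Rightarrow> 'a rel \<Rightarrow> ('a \<Rightarrow> letter) \<Rightarrow> H"
  where "poset_word X r \<delta> = (\<Sum>xs\<in>linear_extensions X r. prod_list (map (\<lambda>x. gen (\<delta> x)) xs))"


section \<open>The element \<open>\<mu>\<close>\<close>

text \<open>All subscripts start at 1, so the entry \<open>l\<^sub>j\<close> of an index \<open>ls\<close> is \<open>ls ! (j - 1)\<close>.\<close>

datatype node = NA nat | NB nat nat

definition mu_nodes :: "nat list \<Rightarrow> nat list \<Rightarrow> node set"
  where "mu_nodes ks ls =
    {NA t | t. 1 \<le> t \<and> t \<le> sum_list ks} \<union>
    {NB j i | j i. 1 \<le> j \<and> j \<le> length ls \<and> 1 \<le> i \<and> i \<le> ls ! (j - 1)}"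

definition mu_relations :: "nat list \<Rightarrow> nat list \<Rightarrow> node rel"
  where "mu_relations ks ls =
    {(NA t, NA (t + 1)) | t. 1 \<le> t \<and> t < sum_list ks} \<union>
    {(NA (sum_list ks), NB (length ls) 1)} \<union>
    {(NB j i, NB j (i + 1)) | j i. 1 \<le> j \<and> j \<le> length ls \<and> 1 \<le> i \<and> i < ls ! (j - 1)} \<union>
    {(NB (j - 1) 1, NB j (ls ! (j - 1))) | j. 2 \<le> j \<and> j \<le> length ls}"

definition mu_order :: "nat list \<Rightarrow> nat list \<Rightarrow> node rel"
  where "mu_order ks ls = (mu_relations ks ls)\<^sup>* \<inter> mu_nodes ks ls \<times> mu_nodes ks ls"

fun mu_label :: "nat list \<Rightarrow> nat list \<Rightarrow> node \<Rightarrow> letter"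
  where
    "mu_label ks ls (NA t) = (if \<exists>j<length ks. t = sum_list (take j ks) + 1 then L1 else L0)"
  | "mu_label ks ls (NB j i) = (if i = 1 \<and> j < length ls then L1 else L0)"

definition mu :: "nat list \<Rightarrow> nat list \<Rightarrow> H"
  where "mu ks ls = poset_word (mu_nodes ks ls) (mu_order ks ls) (mu_label ks ls)"


section \<open>Agreement with the defining properties\<close>

definition index_word :: "nat list \<Rightarrow> fword"
  where "index_word ks = Word (concat (map (\<lambda>k. L1 # replicate (k - 1) L0) ks))"

lemma e0_power: "e0 ^ n = Poly_Mapping.single (Word (replicate n L0)) 1"
  by (induction n) (simp_all add: gen_def mult_single plus_fword_def flip: zero_fword_def)

lemma ek_eq: "ek k = Poly_Mapping.single (Word (L1 # replicate (k - 1) L0)) 1"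
  by (simp add: ek_def e0_power gen_def[of L1] mult_single plus_fword_def)

lemma idx_Nil [simp]: "idx [] = 1"
  by (simp add: idx_def)

lemma idx_Cons: "idx (k # ks) = ek k * idx ks"
  by (simp add: idx_def)

lemma idx_append: "idx (ks @ ls) = idx ks * idx ls"
  by (simp add: idx_def)

lemma idx_eq: "idx ks = Poly_Mapping.single (index_word ks) 1"
  by (induction ks)
    (simp_all add: idx_Cons ek_eq mult_single plus_fword_def index_word_def flip: zero_fword_def)

lemma single_1_inject: "Poly_Mapping.single u (1 :: rat) = Poly_Mapping.single w 1 \<longleftrightarrow> u = w"
  by (metis keys_single one_neq_zero singleton_inject)

lemma replicate_append_L1:
  assumes "replicate a L0 @ concat (map (\<lambda>k. L1 # replicate (k - 1) L0) ks) =
    replicate b L0 @ concat (map (\<lambda>k. L1 # replicate (k - 1) L0) ls)"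
  shows "a = b \<and> concat (map (\<lambda>k. L1 # replicate (k - 1) L0) ks) =
    concat (map (\<lambda>k. L1 # replicate (k - 1) L0) ls)"
  using assms
proof (induction a arbitrary: b)
  case 0
  then show ?case by (cases b; cases ks) auto
next
  case (Suc a)
  then show ?case by (cases b; cases ls) auto
qed

lemma index_word_inj:
  assumes "is_index ks" "is_index ls" "index_word ks = index_word ls"
  shows "ks = ls"
  using assms
proof (induction ks arbitrary: ls)
  case Nil
  then show ?case by (cases ls) (auto simp: index_word_def)
next
  case (Cons k ks)
  from Cons.prems obtain l ls' where ls: "ls = l # ls'"
    by (cases ls) (auto simp: index_word_def)
  from Cons.prems ls have
    "k - 1 = l - 1 \<and> concat (map (\<lambda>k. L1 # replicate (k - 1) L0) ks) =
      concat (map (\<lambda>k. L1 # replicate (k - 1) L0) ls')"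
    by (intro replicate_append_L1) (simp add: index_word_def)
  moreover from this have "ks = ls'"
    using Cons.prems(1,2) ls by (intro Cons.IH) (simp_all add: is_index_def index_word_def)
  ultimately show ?case
    using Cons.prems(1,2) ls by (auto simp: is_index_def)
qed

lemma index_of_index_word [simp]:
  assumes "is_index ks"
  shows "index_of (index_word ks) = ks"
  unfolding index_of_def
proof (rule the_equality)
  show "is_index ks \<and> idx ks = Poly_Mapping.single (index_word ks) 1"
    using assms by (simp add: idx_eq)
next
  fix ls
  assume "is_index ls \<and> idx ls = Poly_Mapping.single (index_word ks) 1"
  then have "is_index ls" "index_word ls = index_word ks" by (simp_all add: idx_eq single_1_inject)
  with assms show "ls = ks" by (intro index_word_inj)
qed

lemma L1_word_index:
  obtains ks where "is_index ks" "ks \<noteq> []" "Word (L1 # w) = index_word ks"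
proof -
  have "\<exists>ks. is_index ks \<and> ks \<noteq> [] \<and> Word (L1 # w) = index_word ks"
  proof (induction "length w" arbitrary: w rule: less_induct)
    case less
    define u where "u = takeWhile (\<lambda>a. a = L0) w"
    define v where "v = dropWhile (\<lambda>a. a = L0) w"
    have w: "w = u @ v" by (simp add: u_def v_def)
    have "\<forall>a\<in>set u. a = L0"
      unfolding u_def by (auto dest: set_takeWhileD)
    then have u: "u = replicate (length u) L0"
      by (metis replicate_length_same)
    show ?case
    proof (cases v)
      case Nil
      have "Word (L1 # w) = index_word [Suc (length u)]"
        using u w Nil by (simp add: index_word_def)
      then show ?thesis
        by (intro exI[of _ "[Suc (length u)]"]) (simp add: is_index_def)
    next
      case (Cons a v')
      have "a \<noteq> L0" using hd_dropWhile[of "\<lambda>a. a = L0" w] Cons unfolding v_def by simp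
      then have a: "a = L1" by (cases a) auto
      have "length v' < length w" using w Cons by simp
      from less[OF this] obtain ks where ks: "is_index ks" "Word (L1 # v') = index_word ks"
        by auto
      have "Word (L1 # w) = index_word (Suc (length u) # ks)"
        using u w Cons a ks by (simp add: index_word_def)
      with ks show ?thesis
        by (intro exI[of _ "Suc (length u) # ks"]) (simp add: is_index_def)
    qed
  qed
  with that show thesis by blast
qed

lemma lookup_scal_mult: "Poly_Mapping.lookup (scal c * p) w = c * Poly_Mapping.lookup p w"
  by (simp add: scal_def lookup_mult lookup_single when_mult)

lemma lookup_mult_scal: "Poly_Mapping.lookup (p * scal c) w = c * Poly_Mapping.lookup p w"
proof -
  have "Poly_Mapping.lookup (p * scal c) w = (\<Sum>q. Poly_Mapping.lookup p q * c when w = q)"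
    unfolding lookup_mult scal_def lookup_single
  proof (rule Sum_any.cong)
    fix a
    have "(\<lambda>q. (c when 0 = q) when w = a + q) = (\<lambda>q. (c when w = a + q) when 0 = q)"
      by (auto simp: when_def fun_eq_iff)
    then have "(\<Sum>q. (c when 0 = q) when w = a + q) = (\<Sum>q. (c when w = a + q) when 0 = q)"
      by (rule arg_cong)
    also have "\<dots> = (c when w = a)" by simp
    finally have "(\<Sum>q. (c when 0 = q) when w = a + q) = (c when w = a)" .
    then show "Poly_Mapping.lookup p a * (\<Sum>q. (c when 0 = q) when w = a + q) =
        (Poly_Mapping.lookup p a * c when w = a)"
      by (simp add: when_def)
  qed
  then show ?thesis by simp
qed

lemma scal_comm: "p * scal c = scal c * p"
  by (rule poly_mapping_eqI) (simp add: lookup_scal_mult lookup_mult_scal)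

lemma scal_simps [simp]: "scal 0 = 0" "scal 1 = 1"
  by (simp_all add: scal_def)

lemma scal_add: "scal (a + b) = scal a + scal b"
  by (simp add: scal_def single_add)

lemma scal_mult: "scal (a * b) = scal a * scal b"
  by (simp add: scal_def mult_single)

lemma lin_ext_superset:
  assumes "finite S" "Poly_Mapping.keys p \<subseteq> S"
  shows "lin_ext f p = (\<Sum>w\<in>S. scal (Poly_Mapping.lookup p w) * f (index_of w))"
  unfolding lin_ext_def using assms
  by (intro sum.mono_neutral_left) (auto simp: in_keys_iff)

lemma lin_ext_0 [simp]: "lin_ext f 0 = 0"
  by (simp add: lin_ext_def)

lemma lin_ext_add: "lin_ext f (p + q) = lin_ext f p + lin_ext f q"
proof -
  let ?S = "Poly_Mapping.keys p \<union> Poly_Mapping.keys q"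
  have "lin_ext f (p + q) = (\<Sum>w\<in>?S. scal (Poly_Mapping.lookup (p + q) w) * f (index_of w))"
    using Poly_Mapping.keys_add[of p q] by (intro lin_ext_superset) auto
  also have "\<dots> = lin_ext f p + lin_ext f q"
    by (simp add: lin_ext_superset[of ?S] lookup_add scal_add distrib_right sum.distrib)
  finally show ?thesis .
qed

lemma lin_ext_scal: "lin_ext f (scal c * p) = scal c * lin_ext f p"
proof -
  have "lin_ext f (scal c * p) =
      (\<Sum>w\<in>Poly_Mapping.keys p. scal (Poly_Mapping.lookup (scal c * p) w) * f (index_of w))"
    by (intro lin_ext_superset) (auto simp: in_keys_iff lookup_scal_mult)
  then show ?thesis
    by (simp add: lin_ext_def lookup_scal_mult scal_mult sum_distrib_left mult.assoc)
qed

lemma lin_ext_sum: "lin_ext f (\<Sum>i\<in>I. p i) = (\<Sum>i\<in>I. lin_ext f (p i))"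
  by (induction I rule: infinite_finite_induct) (simp_all add: lin_ext_add)

lemma lin_ext_idx [simp]: "is_index ks \<Longrightarrow> lin_ext f (idx ks) = f ks"
  by (simp add: lin_ext_def idx_eq)

lemma lin_ext_fun_add: "lin_ext (\<lambda>ks. f ks + g ks) p = lin_ext f p + lin_ext g p"
  by (simp add: lin_ext_def distrib_left sum.distrib)

lemma lin_ext_fun_scal: "lin_ext (\<lambda>ks. scal c * f ks) p = scal c * lin_ext f p"
  unfolding lin_ext_def sum_distrib_left
  by (rule sum.cong) (simp, metis mult.assoc scal_comm)

lemma lin_ext_fun_0: "lin_ext (\<lambda>ks. 0) p = 0"
  by (simp add: lin_ext_def)

lemma keys_H1:
  assumes "p \<in> H1" "w \<in> Poly_Mapping.keys p"
  obtains ks where "is_index ks" "w = index_word ks"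
proof -
  from assms obtain c q where p: "p = scal c + e1 * q" by (auto simp: H1_def)
  have "w \<in> Poly_Mapping.keys (scal c) \<or> w \<in> Poly_Mapping.keys (e1 * q)"
    using assms(2) Poly_Mapping.keys_add[of "scal c" "e1 * q"] p by auto
  then show thesis
  proof
    assume "w \<in> Poly_Mapping.keys (scal c)"
    then have "w = index_word []"
      by (simp add: scal_def index_word_def zero_fword_def split: if_splits)
    then show thesis using that[of "[]"] by (simp add: is_index_def)
  next
    assume "w \<in> Poly_Mapping.keys (e1 * q)"
    then obtain u where "w = Word [L1] + u"
      using keys_mult[of e1 q] by (auto simp: gen_def split: if_splits)
    then have "w = Word (L1 # letters u)" by (simp add: plus_fword_def)
    then show thesis using L1_word_index[of "letters u"] that by metis
  qed
qed

lemma lin_ext_idx_H1: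
  assumes "p \<in> H1"
  shows "lin_ext idx p = p"
proof -
  have "lin_ext idx p =
      (\<Sum>w\<in>Poly_Mapping.keys p. Poly_Mapping.single w (Poly_Mapping.lookup p w))"
    unfolding lin_ext_def
  proof (rule sum.cong)
    fix w
    assume "w \<in> Poly_Mapping.keys p"
    then obtain ks where "is_index ks" "w = index_word ks" using keys_H1[OF assms] by blast
    then show "scal (Poly_Mapping.lookup p w) * idx (index_of w) =
        Poly_Mapping.single w (Poly_Mapping.lookup p w)"
      by (simp add: scal_def idx_eq mult_single)
  qed simp
  also have "\<dots> = p"
    by (rule poly_mapping_eqI)
      (auto simp: lookup_sum lookup_single when_def in_keys_iff)
  finally show ?thesis .
qed

lemma H1_induct [consumes 1, case_names 0 add]:
  assumes "p \<in> H1" and "P 0"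
    and step: "\<And>c ks q. is_index ks \<Longrightarrow> P q \<Longrightarrow> P (scal c * idx ks + q)"
  shows "P p"
proof -
  have "P (\<Sum>w\<in>S. scal (Poly_Mapping.lookup p w) * idx (index_of w))"
    if "finite S" "S \<subseteq> Poly_Mapping.keys p" for S
    using that
  proof (induction S rule: finite_induct)
    case empty
    then show ?case using assms(2) by simp
  next
    case (insert w S)
    obtain ks where "is_index ks" "w = index_word ks" using keys_H1[OF assms(1)] insert by blast
    then show ?case using insert step by simp
  qed
  from this[of "Poly_Mapping.keys p"] show ?thesis
    using lin_ext_idx_H1[OF assms(1)] by (simp add: lin_ext_def)
qed

lemma is_index_Nil [simp]: "is_index []"
  by (simp add: is_index_def)

lemma is_index_Cons [simp]: "is_index (k # ks) \<longleftrightarrow> 1 \<le> k \<and> is_index ks"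
  by (simp add: is_index_def)

lemma is_index_append [simp]: "is_index (ks @ ls) \<longleftrightarrow> is_index ks \<and> is_index ls"
  by (auto simp: is_index_def)

lemma is_index_butlast [simp]: "is_index ks \<Longrightarrow> is_index (butlast ks)"
  by (auto simp: is_index_def dest: in_set_butlastD)

lemma bilinear_lin_ext:
  fixes F :: "H \<Rightarrow> H \<Rightarrow> H"
  assumes "F = (\<lambda>p q. lin_ext (\<lambda>ks. lin_ext (f ks) q) p)"
  shows "F 0 q = 0" "F p 0 = 0" "F (p + p') q = F p q + F p' q" "F p (q + q') = F p q + F p q'"
    "F (scal c * p) q = scal c * F p q" "F p (scal c * q) = scal c * F p q"
    "is_index ks \<Longrightarrow> is_index ls \<Longrightarrow> F (idx ks) (idx ls) = f ks ls"
  by (simp_all add: assms lin_ext_add lin_ext_scal lin_ext_fun_add lin_ext_fun_scal lin_ext_fun_0)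

lemmas harm_bilinear =
  bilinear_lin_ext[where F = harm and f = harm_index, OF ext, OF ext, OF harm_def]

lemmas circ_harm_bilinear =
  bilinear_lin_ext[where F = circ_harm and f = circ_harm_index, OF ext, OF ext, OF circ_harm_def]

lemma ek_scal: "ek k * (scal c * p) = scal c * (ek k * p)"
  by (metis mult.assoc scal_comm)

lemma harm_1_left: "w \<in> H1 \<Longrightarrow> harm 1 w = w"
proof (induction w rule: H1_induct)
  case (add c ls q)
  then show ?case
    using harm_bilinear(7)[of "[]" ls] by (simp add: harm_bilinear)
qed (simp add: harm_bilinear)

lemma harm_1_right: "w \<in> H1 \<Longrightarrow> harm w 1 = w"
proof (induction w rule: H1_induct)
  case (add c ls q)
  have "harm_index ls [] = idx ls" by (cases ls) simp_all
  with add show ?case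
    using harm_bilinear(7)[of ls "[]"] by (simp add: harm_bilinear)
qed (simp add: harm_bilinear)

lemma harm_rec:
  assumes "1 \<le> k" "1 \<le> l" "v \<in> H1" "w \<in> H1"
  shows "harm (ek k * v) (ek l * w) =
    ek k * harm v (ek l * w) + ek l * harm (ek k * v) w + ek (k + l) * harm v w"
  using \<open>v \<in> H1\<close>
proof (induction v rule: H1_induct)
  case (add c ks v)
  have "harm (ek k * idx ks) (ek l * w) =
      ek k * harm (idx ks) (ek l * w) + ek l * harm (ek k * idx ks) w +
      ek (k + l) * harm (idx ks) w"
    using \<open>w \<in> H1\<close>
  proof (induction w rule: H1_induct)
    case (add d ls w)
    have "harm (ek k * idx ks) (ek l * idx ls) =
        ek k * harm (idx ks) (ek l * idx ls) + ek l * harm (ek k * idx ks) (idx ls) +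
        ek (k + l) * harm (idx ks) (idx ls)"
      using \<open>is_index ks\<close> \<open>is_index ls\<close> assms(1,2)
      by (simp add: harm_bilinear(7) flip: idx_Cons)
    with add.IH show ?case
      by (simp add: harm_bilinear distrib_left ek_scal algebra_simps)
  qed (simp add: harm_bilinear)
  with add.IH show ?case
    by (simp add: harm_bilinear distrib_left ek_scal algebra_simps)
qed (simp add: harm_bilinear)

lemma circ_harm_eq:
  assumes "1 \<le> k" "1 \<le> l" "v \<in> H1" "w \<in> H1"
  shows "circ_harm (v * ek k) (w * ek l) = harm v w * ek (k + l)"
  using \<open>v \<in> H1\<close>
proof (induction v rule: H1_induct)
  case (add c ks v)
  have "circ_harm (idx ks * ek k) (w * ek l) = harm (idx ks) w * ek (k + l)"
    using \<open>w \<in> H1\<close>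
  proof (induction w rule: H1_induct)
    case (add d ls w)
    have *: "idx js * ek j = idx (js @ [j])" for js j
      by (simp add: idx_append idx_Cons)
    have "circ_harm (idx ks * ek k) (idx ls * ek l) = harm (idx ks) (idx ls) * ek (k + l)"
      using \<open>is_index ks\<close> \<open>is_index ls\<close> assms(1,2)
      unfolding * by (simp add: circ_harm_bilinear(7) circ_harm_index_def)
    with add.IH show ?case
      by (simp add: circ_harm_bilinear harm_bilinear distrib_left distrib_right mult.assoc)
  qed (simp add: harm_bilinear circ_harm_bilinear)
  with add.IH show ?case
    by (simp add: circ_harm_bilinear harm_bilinear distrib_left distrib_right mult.assoc)
qed (simp add: harm_bilinear circ_harm_bilinear)

lemma H1_add: "p \<in> H1 \<Longrightarrow> q \<in> H1 \<Longrightarrow> p + q \<in> H1"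
proof -
  assume "p \<in> H1" "q \<in> H1"
  then obtain c p' d q' where "p = scal c + e1 * p'" "q = scal d + e1 * q'"
    by (auto simp: H1_def)
  then have "p + q = scal (c + d) + e1 * (p' + q')"
    by (simp add: scal_add algebra_simps)
  then show "p + q \<in> H1" unfolding H1_def by blast
qed

lemma ek_mult_H1: "ek k * p \<in> H1"
  unfolding H1_def ek_def mem_Collect_eq
  by (intro exI[of _ 0] exI[of _ "e0 ^ (k - 1) * p"]) (simp add: mult.assoc)

lemma idx_H1: "idx ks \<in> H1"
proof (cases ks)
  case Nil
  show ?thesis
    unfolding H1_def mem_Collect_eq Nil by (intro exI[of _ 1] exI[of _ 0]) simp
qed (simp add: idx_Cons ek_mult_H1)

lemma harm_index_H1: "harm_index ks ls \<in> H1"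
  by (induction ks ls rule: harm_index.induct) (simp_all add: idx_H1 H1_add ek_mult_H1)

lemma H0_add: "p \<in> H0 \<Longrightarrow> q \<in> H0 \<Longrightarrow> p + q \<in> H0"
proof -
  assume "p \<in> H0" "q \<in> H0"
  then obtain c p' d q' where "p = scal c + e1 * p' * e0" "q = scal d + e1 * q' * e0"
    by (auto simp: H0_def)
  then have "p + q = scal (c + d) + e1 * (p' + q') * e0"
    by (simp add: scal_add algebra_simps)
  then show "p + q \<in> H0" unfolding H0_def by blast
qed

lemma e1_e0_H0: "e1 * p * e0 \<in> H0"
  unfolding H0_def mem_Collect_eq by (intro exI[of _ 0] exI[of _ p]) simp

lemma H0_sum: "(\<And>i. i \<in> I \<Longrightarrow> p i \<in> H0) \<Longrightarrow> (\<Sum>i\<in>I. p i) \<in> H0"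
proof (induction I rule: infinite_finite_induct)
  case (insert i I)
  then show ?case by (simp add: H0_add)
qed (use e1_e0_H0[of 0] in simp_all)

lemma H1_mult_ek_H0:
  assumes "p \<in> H1" "2 \<le> k"
  shows "p * ek k \<in> H0"
proof -
  from assms obtain c q where p: "p = scal c + e1 * q" by (auto simp: H1_def)
  obtain n where k: "k - 1 = Suc n" using \<open>2 \<le> k\<close> by (cases "k - 1") auto
  have "p * ek k = e1 * (scal c * e0 ^ n + q * e1 * e0 ^ n) * e0"
    unfolding p ek_def k power_Suc2 using scal_comm[of e1 c, symmetric]
    by (simp add: distrib_left distrib_right mult.assoc[symmetric])
  then show ?thesis by (simp add: e1_e0_H0)
qed

lemma fill_index: "is_index ls \<Longrightarrow> ls \<noteq> [] \<Longrightarrow> is_index (fill ls cs) \<and> fill ls cs \<noteq> []"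
  by (induction ls cs rule: fill.induct) auto

lemma circ_harm_star_H0:
  assumes "is_index ks" "ks \<noteq> []" "is_index ls" "ls \<noteq> []"
  shows "circ_harm (idx ks) (star ls) \<in> H0"
proof -
  have "circ_harm_index ks js \<in> H0" if "is_index js" "js \<noteq> []" for js
  proof -
    have "1 \<le> last ks" "1 \<le> last js"
      using assms that by (auto simp: is_index_def)
    then show ?thesis
      using assms that
      by (simp add: circ_harm_index_def harm_bilinear(7) H1_mult_ek_H0 harm_index_H1)
  qed
  moreover have "circ_harm (idx ks) (star ls) =
      (\<Sum>cs | length cs = length ls - 1. circ_harm_index ks (fill ls cs))"
    using assms fill_index[of ls] by (simp add: circ_harm_def star_def lin_ext_sum)
  ultimately show ?thesis
    using assms fill_index[of ls] by (auto intro!: H0_sum)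
qed

lemma keys_H0:
  assumes "p \<in> H0" "w \<in> Poly_Mapping.keys p"
  obtains ks where "admissible ks" "w = index_word ks"
proof -
  from assms obtain c q where p: "p = scal c + e1 * q * e0" by (auto simp: H0_def)
  then have "p \<in> H1" by (auto simp: H1_def mult.assoc)
  from keys_H1[OF this assms(2)] obtain ks where ks: "is_index ks" "w = index_word ks" .
  have "w \<in> Poly_Mapping.keys (scal c) \<or> w \<in> Poly_Mapping.keys (e1 * q * e0)"
    using assms(2) Poly_Mapping.keys_add[of "scal c" "e1 * q * e0"] p by auto
  then have "letters w = [] \<or> last (letters w) = L0"
  proof
    assume "w \<in> Poly_Mapping.keys (scal c)"
    then show ?thesis by (simp add: scal_def zero_fword_def split: if_splits)
  next
    assume "w \<in> Poly_Mapping.keys (e1 * q * e0)"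
    then obtain u where "w = u + Word [L0]"
      using keys_mult[of "e1 * q" e0] by (auto simp: gen_def split: if_splits)
    then show ?thesis by (simp add: plus_fword_def)
  qed
  moreover have "last (letters w) = L1" "letters w \<noteq> []" if "ks \<noteq> []" "\<not> 2 \<le> last ks"
  proof -
    have "ks = butlast ks @ [1]"
    proof -
      have "1 \<le> last ks" using that(1) ks(1) by (simp add: is_index_def)
      then have "last ks = 1" using that(2) by simp
      then show ?thesis using that(1) append_butlast_last_id[of ks] by simp
    qed
    then have "index_word ks = index_word (butlast ks @ [1])" by simp
    then have "letters w = letters (index_word (butlast ks)) @ [L1]"
      by (simp add: ks(2) index_word_def)
    then show "last (letters w) = L1" "letters w \<noteq> []" by auto
  qed
  ultimately have "admissible ks"
    unfolding admissible_def using ks(1) by (metis letter.distinct(1))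
  with ks(2) that show thesis by blast
qed

lemma zeta_idx: "is_index ks \<Longrightarrow> zeta (idx ks) = zeta_index ks"
  by (simp add: zeta_def idx_eq)

lemma zeta_index_Nil: "zeta_index [] = 1"
proof -
  have "{ms :: nat list. length ms = 0 \<and> sorted_wrt (<) ms \<and> (\<forall>m\<in>set ms. 0 < m)} = {[]}"
    by auto
  then show ?thesis by (simp add: zeta_index_def)
qed

lemma mu_relations_nodes:
  assumes "is_index ks" "ks \<noteq> []" "is_index ls" "ls \<noteq> []"
  shows "mu_relations ks ls \<subseteq> mu_nodes ks ls \<times> mu_nodes ks ls"
proof -
  have l: "1 \<le> ls ! (j - 1)" if "1 \<le> j" "j \<le> length ls" for j
    using assms that by (auto simp: is_index_def)
  have "1 \<le> sum_list ks" using assms by (cases ks) auto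
  moreover have "1 \<le> length ls" using assms by (cases ls) auto
  moreover have "NB (j - 1) 1 \<in> mu_nodes ks ls" "NB j (ls ! (j - 1)) \<in> mu_nodes ks ls"
    if "2 \<le> j" "j \<le> length ls" for j
    using that l[of "j - 1"] l[of j] by (auto simp: mu_nodes_def)
  moreover have "NB (length ls) 1 \<in> mu_nodes ks ls"
    using \<open>1 \<le> length ls\<close> l[of "length ls"] by (simp add: mu_nodes_def)
  moreover have "NA t \<in> mu_nodes ks ls" if "1 \<le> t" "t \<le> sum_list ks" for t
    using that by (simp add: mu_nodes_def)
  moreover have "NB j i \<in> mu_nodes ks ls"
    if "1 \<le> j" "j \<le> length ls" "1 \<le> i" "i \<le> ls ! (j - 1)" for j i
    using that by (simp add: mu_nodes_def)
  ultimately show ?thesis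
    unfolding mu_relations_def by auto
qed

lemma finite_mu_nodes: "finite (mu_nodes ks ls)"
proof -
  have "mu_nodes ks ls = NA ` {1..sum_list ks} \<union>
      (\<Union>j\<in>{1..length ls}. NB j ` {1..ls ! (j - 1)})"
    by (auto simp: mu_nodes_def)
  then show ?thesis by simp
qed

lemma mu_two_poset:
  assumes "is_index ks" "ks \<noteq> []" "is_index ls" "ls \<noteq> []"
  shows "two_poset (mu_nodes ks ls) (mu_order ks ls)"
proof -
  define rank where
    "rank x = (case x of NA t \<Rightarrow> t | NB j i \<Rightarrow> sum_list ks + j + i)" for x
  have l: "1 \<le> ls ! (j - 1)" if "1 \<le> j" "j \<le> length ls" for j
    using assms that by (auto simp: is_index_def)
  have "rank x < rank y" if "(x, y) \<in> mu_relations ks ls" for x y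
    using that l unfolding mu_relations_def rank_def by (auto simp: Suc_le_eq)
  then have "mu_relations ks ls \<subseteq> inv_image less_than rank" by (auto simp: inv_image_def)
  then have "acyclic (mu_relations ks ls)"
    by (rule wf_acyclic[OF wf_subset[OF wf_inv_image[OF wf_less_than]]])
  then have "antisym ((mu_relations ks ls)\<^sup>*)" by (rule acyclic_impl_antisym_rtrancl)
  then have "antisym (mu_order ks ls)"
    unfolding mu_order_def by (auto simp: antisym_def)
  moreover have "trans (mu_order ks ls)"
    unfolding mu_order_def by (rule transI) (auto intro: rtrancl_trans)
  moreover have "refl_on (mu_nodes ks ls) (mu_order ks ls)"
    by (simp add: mu_order_def refl_on_def)
  ultimately show ?thesis
    using finite_mu_nodes[of ks ls]
    by (auto simp: two_poset_def partial_order_on_def preorder_on_def mu_order_def)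
qed

lemma prod_list_gen:
  "prod_list (map (\<lambda>x. gen (\<delta> x)) xs) = Poly_Mapping.single (Word (map \<delta> xs)) 1"
  by (induction xs) (simp_all add: gen_def mult_single plus_fword_def flip: zero_fword_def)

lemma mu_H0:
  assumes "is_index ks" "ks \<noteq> []" "is_index ls" "ls \<noteq> []"
  shows "mu ks ls \<in> H0"
  unfolding mu_def poset_word_def
proof (rule H0_sum)
  fix xs
  let ?\<delta> = "mu_label ks ls" and ?X = "mu_nodes ks ls" and ?R = "mu_relations ks ls"
  assume "xs \<in> linear_extensions ?X (mu_order ks ls)"
  then have xs: "distinct xs" "set xs = ?X"
    and le: "\<And>i j. i < length xs \<Longrightarrow> j < length xs \<Longrightarrow>
        (xs ! i, xs ! j) \<in> mu_order ks ls \<Longrightarrow> xs ! i \<noteq> xs ! j \<Longrightarrow> i < j"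
    by (auto simp: linear_extensions_def)
  have irrefl: "x \<noteq> y" if "(x, y) \<in> ?R" for x y
    using that assms by (auto simp: mu_relations_def)
  have R: "\<exists>i j. i < j \<and> i < length xs \<and> j < length xs \<and> x = xs ! i \<and> y = xs ! j"
    if "(x, y) \<in> ?R" for x y
  proof -
    have "x \<in> ?X" "y \<in> ?X" using that mu_relations_nodes[OF assms] by auto
    moreover from this that have "(x, y) \<in> mu_order ks ls" by (auto simp: mu_order_def)
    moreover from calculation obtain i j where
      "i < length xs" "x = xs ! i" "j < length xs" "y = xs ! j"
      unfolding xs(2)[symmetric] by (auto simp: in_set_conv_nth)
    ultimately show ?thesis
      using le[of i j] irrefl[OF that] by blast
  qed
  have "1 \<le> sum_list ks" using assms by (cases ks) auto
  then have "NA 1 \<in> ?X" by (simp add: mu_nodes_def)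
  then have ne: "xs \<noteq> []" using xs by auto
  have first: "?\<delta> (hd xs) = L1"
  proof (rule ccontr)
    assume neg: "?\<delta> (hd xs) \<noteq> L1"
    have "hd xs \<in> ?X" using hd_in_set[OF ne] unfolding xs(2) .
    have "\<exists>y. (y, hd xs) \<in> ?R"
    proof (cases "hd xs")
      case (NA t)
      have "t \<noteq> 0 + 1"
      proof
        assume "t = 0 + 1"
        then have "\<exists>j<length ks. t = sum_list (take j ks) + 1"
          using assms by (intro exI[of _ 0]) simp
        with neg NA show False by simp
      qed
      moreover have "1 \<le> t" "t \<le> sum_list ks" using NA \<open>hd xs \<in> ?X\<close> by (auto simp: mu_nodes_def)
      ultimately have "(NA (t - 1), NA (t - 1 + 1)) \<in> ?R" "t - 1 + 1 = t"
        unfolding mu_relations_def by auto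
      then show ?thesis using NA by metis
    next
      case (NB j i)
      have ji: "1 \<le> j" "j \<le> length ls" "1 \<le> i" "i \<le> ls ! (j - 1)"
        using NB \<open>hd xs \<in> ?X\<close> by (auto simp: mu_nodes_def)
      show ?thesis
      proof (cases "i = 1")
        case True
        with neg NB ji have "j = length ls" by (auto split: if_splits)
        then show ?thesis using NB True by (auto simp: mu_relations_def)
      next
        case False
        then have "(NB j (i - 1), NB j (i - 1 + 1)) \<in> ?R" "i - 1 + 1 = i"
          using ji unfolding mu_relations_def by auto
        then show ?thesis using NB by metis
      qed
    qed
    then obtain y where "(y, hd xs) \<in> ?R" ..
    from R[OF this] obtain i j where "i < j" "j < length xs" "xs ! 0 = xs ! j"
      using ne by (auto simp: hd_conv_nth)
    then show False using xs(1) ne nth_eq_iff_index_eq[of xs 0 j] by simp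
  qed
  have last: "?\<delta> (last xs) = L0"
  proof (rule ccontr)
    assume neg: "?\<delta> (last xs) \<noteq> L0"
    have "last xs \<in> ?X" using last_in_set[OF ne] unfolding xs(2) .
    have "\<exists>y. (last xs, y) \<in> ?R"
    proof (cases "last xs")
      case (NA t)
      then have "1 \<le> t" "t \<le> sum_list ks" using \<open>last xs \<in> ?X\<close> by (auto simp: mu_nodes_def)
      then show ?thesis using NA by (cases "t = sum_list ks") (auto simp: mu_relations_def)
    next
      case (NB j i)
      with neg have "i = 1" "j < length ls" by (auto split: if_splits)
      moreover have "1 \<le> j" using NB \<open>last xs \<in> ?X\<close> by (auto simp: mu_nodes_def)
      ultimately have "2 \<le> j + 1" "j + 1 \<le> length ls" by simp_all
      then have "(NB (j + 1 - 1) 1, NB (j + 1) (ls ! (j + 1 - 1))) \<in> ?R"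
        unfolding mu_relations_def by blast
      then have "(last xs, NB (j + 1) (ls ! j)) \<in> ?R"
        using NB \<open>i = 1\<close> by simp
      then show ?thesis ..
    qed
    then obtain y where "(last xs, y) \<in> ?R" ..
    from R[OF this] obtain i j where "i < j" "j < length xs" "xs ! (length xs - 1) = xs ! i"
      using ne by (auto simp: last_conv_nth)
    then show False using xs(1) nth_eq_iff_index_eq[of xs "length xs - 1" i] by simp
  qed
  obtain x ys where x: "xs = x # ys" using ne by (cases xs) auto
  have "ys \<noteq> []" using first last x by auto
  then obtain zs z where "ys = zs @ [z]" by (metis rev_exhaust)
  with x first last have "prod_list (map (\<lambda>x. gen (?\<delta> x)) xs) =
      e1 * prod_list (map (\<lambda>x. gen (?\<delta> x)) zs) * e0"
    by (simp add: mult.assoc)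
  then show "prod_list (map (\<lambda>x. gen (?\<delta> x)) xs) \<in> H0" by (simp add: e1_e0_H0)
qed

end

theory Submission
  imports Defs
begin

text \<open>
  Put \<open>\<omega>\<^sub>0(t) = dt / t\<close> and \<open>\<omega>\<^sub>1(t) = dt / (1 - t)\<close>. A multiple zeta value is the integral of a product
  of these forms over a simplex \<open>0 < t\<^sub>1 < \<dots> < t\<^sub>n < 1\<close>; summing over linear extensions, \<open>\<zeta>(W(X))\<close> is
  the integral over all \<open>t \<in> (0, 1)\<^sup>X\<close> that respect the order of \<open>X\<close>. The Hasse diagram of the poset
  of \<open>\<mu>(k, l)\<close> is a path that zigzags from \<open>a\<^sub>1\<close> to \<open>b\<^sub>1\<^sub>,\<^sub>l\<^sub>1\<close>, so the variables can be integrated out one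
  after the other along it. Going up multiplies the coefficient of \<open>t\<^sup>n\<close> by \<open>1 / n\<close>, and going down
  from a peak turns \<open>t\<^sup>n\<close> into \<open>(1 - t\<^sup>n) / (n (1 - t))\<close>, that is, into the sum of the \<open>t\<^sup>q\<^sup>-\<^sup>1 / n\<close>
  over \<open>1 \<le> q \<le> n\<close>. The result is the series that defines the right-hand side.

  All integrands are nonnegative, so everything takes place in \<open>[0, \<infinity>]\<close>, and convergence is only
  needed to return from there to real numbers.
\<close>

section \<open>Multiple harmonic sums\<close>

text \<open>The integral over \<open>(0,1)^X\<close> is never formed. An induction along the path
  works because one variable \<open>t\<close> stays free, that of the current end of the path: each
  linear extension then contributes an iterated integral over the variables below \<open>t\<close>,
  the form at \<open>t\<close>, and an iterated integral over the variables above \<open>t\<close>.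
  A new end may be inserted at any place on the prescribed side of the old one, and integrating out
  the old variable gives a sum over exactly these places. This matches \<open>dens\<close> with
  \<open>zippers\<close> term by term.

  Along the \<open>b\<close>-part every density is a power series without constant term times
  \<open>dt / t\<close>. The step down to a node with label \<open>L1\<close> seems to break this
  shape, but the factor \<open>1 - t\<close> cancels and \<open>t^(q-1)\<close> is again
  \<open>t^q / t\<close>, so a single invariant suffices.

  Both sides end in the series over the common variable \<open>n = m_r = n_s\<close> with terms
  \<open>last_sum 0 n ks * star_sum 1 n ls\<close>. Its convergence rests on a crude square root
  bound; on the integral side, every word of \<open>mu ks ls\<close> is admissible by
  \<open>mu_H0\<close>.\<close>

primrec strict_sum :: "nat \<Rightarrow> nat \<Rightarrow> nat list \<Rightarrow> real"
  where
    "strict_sum a n [] = 1"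
  | "strict_sum a n (k # ks) = (\<Sum>m\<in>{a<..<n}. 1 / real m ^ k * strict_sum m n ks)"

text \<open>
  In the next two sums the last summation variable is fixed to be \<open>n\<close>; the first one runs over
  \<open>a < m\<^sub>1 < \<dots> < m\<^sub>r = n\<close>, the second one over \<open>a \<le> n\<^sub>1 \<le> \<dots> \<le> n\<^sub>s = n\<close>.
\<close>

primrec last_sum :: "nat \<Rightarrow> nat \<Rightarrow> nat list \<Rightarrow> real"
  where
    "last_sum a n [] = (if a = n then 1 else 0)"
  | "last_sum a n (k # ks) = (\<Sum>m\<in>{a<..n}. 1 / real m ^ k * last_sum m n ks)"

primrec star_sum :: "nat \<Rightarrow> nat \<Rightarrow> nat list \<Rightarrow> real"
  where
    "star_sum a n [] = (if a = n then 1 else 0)"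
  | "star_sum a n (l # ls) = (\<Sum>p\<in>{a..n}. 1 / real p ^ l * star_sum p n ls)"

lemma strict_sum_nonneg: "0 \<le> strict_sum a n ks"
  by (induction ks arbitrary: a) (auto intro!: sum_nonneg)

lemma last_sum_nonneg: "0 \<le> last_sum a n ks"
  by (induction ks arbitrary: a) (auto intro!: sum_nonneg)

lemma star_sum_nonneg: "0 \<le> star_sum a n ks"
  by (induction ks arbitrary: a) (auto intro!: sum_nonneg)

lemma sum_swap_greaterThanLessThan:
  fixes f :: "nat \<Rightarrow> nat \<Rightarrow> 'a::comm_monoid_add"
  shows "(\<Sum>m\<in>{a<..<n}. \<Sum>p\<in>{m<..<n}. f m p) = (\<Sum>p\<in>{a<..<n}. \<Sum>m\<in>{a<..<p}. f m p)"
proof -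
  have "(\<Sum>m\<in>{a<..<n}. \<Sum>p\<in>{m<..<n}. f m p) =
      (\<Sum>m\<in>{a<..<n}. \<Sum>p | p \<in> {a<..<n} \<and> m < p. f m p)"
    by (intro sum.cong) auto
  also have "\<dots> = (\<Sum>p\<in>{a<..<n}. \<Sum>m | m \<in> {a<..<n} \<and> m < p. f m p)"
    by (rule sum.swap_restrict) auto
  also have "\<dots> = (\<Sum>p\<in>{a<..<n}. \<Sum>m\<in>{a<..<p}. f m p)"
    by (intro sum.cong) auto
  finally show ?thesis .
qed

lemma strict_sum_snoc:
  "strict_sum a n (ks @ [k]) = (\<Sum>m\<in>{a<..<n}. strict_sum a m ks / real m ^ k)"
proof (induction ks arbitrary: a)
  case (Cons j ks)
  have "strict_sum a n ((j # ks) @ [k]) =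
      (\<Sum>m\<in>{a<..<n}. \<Sum>p\<in>{m<..<n}. 1 / real m ^ j * strict_sum m p ks / real p ^ k)"
    by (simp add: Cons sum_distrib_left)
  then show ?case
    by (simp add: sum_swap_greaterThanLessThan sum_divide_distrib)
qed simp

lemma last_sum_diag: "ks \<noteq> [] \<Longrightarrow> last_sum n n ks = 0"
  by (cases ks) auto

text \<open>The last variable is forced to be \<open>n\<close>, so its factor comes out and the
  others stay strictly below \<open>n\<close>. For \<open>a = n > 0\<close> and
  \<open>ks = []\<close> the left side is an empty sum while the right side is positive, hence
  \<open>a < n\<close>.\<close>

lemma last_sum_snoc:
  assumes "a < n"
  shows "last_sum a n (ks @ [k]) = strict_sum a n ks / real n ^ k"
  using assms
proof (induction ks arbitrary: a)
  case Nil
  have "last_sum a n ([] @ [k]) = (\<Sum>m\<in>{a<..n}. if m = n then 1 / real n ^ k else 0)"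
    unfolding append_Nil last_sum.simps by (intro sum.cong) auto
  also have "\<dots> = 1 / real n ^ k" using Nil by simp
  finally show ?case by (simp only: strict_sum.simps)
next
  case (Cons j ks)
  have "last_sum a n ((j # ks) @ [k]) =
      (\<Sum>m\<in>{a<..<n}. 1 / real m ^ j * last_sum m n (ks @ [k]))"
    unfolding append_Cons last_sum.simps using Cons.prems
    by (intro sum.mono_neutral_right) (auto simp: last_sum_diag le_less)
  then show ?case
    using Cons by (simp add: sum_divide_distrib)
qed

text \<open>Tuples are sorted by their largest variable \<open>m\<close>. The range starts at
  \<open>a\<close> itself because the empty tuple is counted by \<open>last_sum\<close> at
  \<open>m = a\<close>.\<close>

lemma strict_sum_eq_sum_last_sum:
  assumes "a < n"
  shows "strict_sum a n ks = (\<Sum>m\<in>{a..<n}. last_sum a m ks)"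
proof (cases ks rule: rev_cases)
  case Nil
  have "(\<Sum>m\<in>{a..<n}. last_sum a m []) = 1"
    using assms by simp
  with Nil show ?thesis by simp
next
  case (snoc js j)
  have "(\<Sum>m\<in>{a..<n}. last_sum a m (js @ [j])) = (\<Sum>m\<in>{a<..<n}. last_sum a m (js @ [j]))"
    by (rule sum.mono_neutral_right) (auto simp: last_sum_diag le_less)
  then show ?thesis
    by (simp add: snoc strict_sum_snoc last_sum_snoc)
qed

text \<open>This is the recursion that the coefficients of the iterated integrals obey when one more
  \<open>e_k\<close> is appended; at \<open>n = 0\<close> both sides vanish.\<close>

lemma last_sum_0_snoc:
  "last_sum 0 n (ks @ [k]) = (\<Sum>m<n. last_sum 0 m ks) / real n ^ k"
proof (cases n)
  case (Suc n')
  then have n: "0 < n" by simp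
  show ?thesis
    unfolding last_sum_snoc[OF n] strict_sum_eq_sum_last_sum[OF n]
    by (simp add: atLeast0LessThan)
qed (simp add: last_sum_diag)


subsection \<open>The harmonic product\<close>

text \<open>The indices of \<open>harm_index\<close> listed with multiplicity, so that real-valued
  functions of an index can be summed over a harmonic product without extending them linearly to
  \<open>H\<close>.\<close>

fun stuffle :: "nat list \<Rightarrow> nat list \<Rightarrow> nat list list"
  where
    "stuffle [] ls = [ls]"
  | "stuffle (k # ks) [] = [k # ks]"
  | "stuffle (k # ks) (l # ls) =
       map ((#) k) (stuffle ks (l # ls)) @ map ((#) l) (stuffle (k # ks) ls) @
       map ((#) (k + l)) (stuffle ks ls)"

lemma harm_index_stuffle: "harm_index ks ls = sum_list (map idx (stuffle ks ls))"
proof (induction ks ls rule: stuffle.induct)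
  case (3 k ks l ls)
  have "sum_list (map idx (map ((#) j) jss)) = ek j * sum_list (map idx jss)" for j jss
    by (induction jss) (simp_all add: idx_Cons distrib_left)
  with 3 show ?case by simp
qed simp_all

lemma is_index_stuffle: "is_index ks \<Longrightarrow> is_index ls \<Longrightarrow> list_all is_index (stuffle ks ls)"
proof (induction ks ls rule: stuffle.induct)
  case (3 k ks l ls)
  from "3.prems" have "1 \<le> k" "1 \<le> l" "1 \<le> k + l" "is_index ks" "is_index ls" by simp_all
  moreover have "list_all is_index (map ((#) j) jss) \<longleftrightarrow> list_all is_index jss" if "1 \<le> j" for j jss
    using that by (induction jss) simp_all
  ultimately show ?case
    using 3 by (simp only: stuffle.simps list_all_append)
qed simp_all

text \<open>Pairs are sorted by which entry is smaller, or whether the two agree; these are the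
  three terms of the recursion for the harmonic product.\<close>

lemma sum_product_greaterThanLessThan:
  fixes f g :: "nat \<Rightarrow> real"
  shows "(\<Sum>m\<in>{a<..<n}. f m) * (\<Sum>m\<in>{a<..<n}. g m) =
    (\<Sum>m\<in>{a<..<n}. f m * (\<Sum>p\<in>{m<..<n}. g p)) +
    (\<Sum>m\<in>{a<..<n}. g m * (\<Sum>p\<in>{m<..<n}. f p)) + (\<Sum>m\<in>{a<..<n}. f m * g m)"
proof -
  have "(\<Sum>p\<in>{a<..<n}. f m * g p) =
      (\<Sum>p\<in>{m<..<n}. f m * g p) + (\<Sum>p\<in>{a<..<m}. f m * g p) + f m * g m"
    if "m \<in> {a<..<n}" for m
  proof -
    have "{a<..<n} = insert m ({m<..<n} \<union> {a<..<m})" using that by auto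
    then show ?thesis by (subst sum.insert_if | subst sum.union_disjoint | auto)+
  qed
  then have "(\<Sum>m\<in>{a<..<n}. f m) * (\<Sum>m\<in>{a<..<n}. g m) =
      (\<Sum>m\<in>{a<..<n}. \<Sum>p\<in>{m<..<n}. f m * g p) + (\<Sum>m\<in>{a<..<n}. \<Sum>p\<in>{a<..<m}. f m * g p) +
      (\<Sum>m\<in>{a<..<n}. f m * g m)"
    by (simp add: sum_product sum.distrib)
  also have "(\<Sum>m\<in>{a<..<n}. \<Sum>p\<in>{a<..<m}. f m * g p) = (\<Sum>p\<in>{a<..<n}. \<Sum>m\<in>{p<..<n}. g p * f m)"
    by (simp add: sum_swap_greaterThanLessThan mult.commute)
  finally show ?thesis by (simp add: sum_distrib_left)
qed

text \<open>Truncating both factors at the same \<open>n\<close> turns the harmonic product rule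
  into an identity of finite sums. The lower bound is arbitrary because the smallest variable
  becomes the next lower bound.\<close>

lemma strict_sum_mult:
  "strict_sum a n ks * strict_sum a n ls = sum_list (map (strict_sum a n) (stuffle ks ls))"
proof (induction ks ls arbitrary: a rule: stuffle.induct)
  case (3 k ks l ls)
  define f where "f m = 1 / real m ^ k * strict_sum m n ks" for m
  define g where "g m = 1 / real m ^ l * strict_sum m n ls" for m
  have cons: "sum_list (map (strict_sum a n) (map ((#) j) jss)) =
      (\<Sum>m\<in>{a<..<n}. 1 / real m ^ j * sum_list (map (strict_sum m n) jss))" for j jss
    by (induction jss) (simp_all add: sum.distrib distrib_left)
  have "f m * (\<Sum>p\<in>{m<..<n}. g p) =
      1 / real m ^ k * sum_list (map (strict_sum m n) (stuffle ks (l # ls)))" for m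
    using "3.IH"(1)[of m] by (simp add: f_def g_def)
  moreover have "g m * (\<Sum>p\<in>{m<..<n}. f p) =
      1 / real m ^ l * sum_list (map (strict_sum m n) (stuffle (k # ks) ls))" for m
    using "3.IH"(2)[of m] by (simp add: f_def g_def mult_ac)
  moreover have "f m * g m =
      1 / real m ^ (k + l) * sum_list (map (strict_sum m n) (stuffle ks ls))" for m
    using "3.IH"(3)[of m] by (simp add: f_def g_def power_add mult_ac flip: "3.IH"(3))
  moreover have "strict_sum a n (k # ks) * strict_sum a n (l # ls) =
      (\<Sum>m\<in>{a<..<n}. f m) * (\<Sum>m\<in>{a<..<n}. g m)"
    by (simp add: f_def g_def)
  ultimately show ?case
    unfolding sum_product_greaterThanLessThan stuffle.simps map_append sum_list_append cons
    by simp
qed simp_all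


subsection \<open>The star sum\<close>

lemma sum_lists_Suc:
  fixes f :: "separator list \<Rightarrow> 'a::comm_monoid_add"
  shows "(\<Sum>cs | length cs = Suc n. f cs) =
    (\<Sum>cs | length cs = n. f (Comma # cs)) + (\<Sum>cs | length cs = n. f (Plus # cs))"
proof -
  have UNIV: "(UNIV :: separator set) = {Comma, Plus}"
    using separator.exhaust by auto
  have fin: "finite {cs :: separator list. length cs = n}"
    using finite_lists_length_eq[of "UNIV :: separator set" n]
    by (metis (mono_tags, lifting) Collect_cong UNIV finite.simps top_greatest)
  have "{cs :: separator list. length cs = Suc n} =
      (#) Comma ` {cs. length cs = n} \<union> (#) Plus ` {cs. length cs = n}"
  proof (intro equalityI subsetI)
    fix cs :: "separator list"
    assume "cs \<in> {cs. length cs = Suc n}"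
    then obtain c ds where "cs = c # ds" "length ds = n" by (auto simp: length_Suc_conv)
    then show "cs \<in> (#) Comma ` {cs. length cs = n} \<union> (#) Plus ` {cs. length cs = n}"
      by (cases c) auto
  qed auto
  then show ?thesis
    using fin by (simp only:) (subst sum.union_disjoint; auto simp: sum.reindex inj_on_def o_def)
qed

lemma star_sum_Suc:
  "p \<le> n \<Longrightarrow> star_sum p n (l # ls) = 1 / real p ^ l * star_sum p n ls + star_sum (Suc p) n (l # ls)"
  unfolding star_sum.simps by (rule sum.atLeast_Suc_atMost)

text \<open>Each \<open><=\<close> between neighbouring variables of the star sum is either
  \<open><\<close>, a comma, or \<open>=\<close>, a plus that adds the exponents. The bound shifts
  to \<open>Suc a\<close> because \<open>last_sum\<close> excludes its lower bound and
  \<open>star_sum\<close> includes it. The induction is on the length, since a plus replaces the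
  first two entries by their sum.\<close>

lemma sum_fill_last_sum:
  assumes "ls \<noteq> []"
  shows "(\<Sum>cs | length cs = length ls - 1. last_sum a n (fill ls cs)) = star_sum (Suc a) n ls"
  using assms
proof (induction "length ls" arbitrary: ls a rule: less_induct)
  case less
  show ?case
  proof (cases ls)
    case (Cons l ms)
    show ?thesis
    proof (cases ms)
      case Nil
      have "{a<..n} = {Suc a..n}" by auto
      with Nil Cons show ?thesis by simp
    next
      case (Cons m js)
      have ls: "ls = l # m # js" by (simp add: Cons \<open>ls = l # ms\<close>)
      have "(\<Sum>cs | length cs = length ls - 1. last_sum a n (fill ls cs)) =
          (\<Sum>cs | length cs = length js. last_sum a n (l # fill (m # js) cs)) +
          (\<Sum>cs | length cs = length js. last_sum a n (fill ((l + m) # js) cs))"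
        by (simp add: ls sum_lists_Suc)
      also have "(\<Sum>cs | length cs = length js. last_sum a n (fill ((l + m) # js) cs)) =
          star_sum (Suc a) n ((l + m) # js)"
        using less.hyps[of "(l + m) # js"] by (simp add: ls)
      also have "(\<Sum>cs | length cs = length js. last_sum a n (l # fill (m # js) cs)) =
          (\<Sum>p\<in>{a<..n}. 1 / real p ^ l *
            (\<Sum>cs | length cs = length js. last_sum p n (fill (m # js) cs)))"
        by (simp only: last_sum.simps sum_distrib_left) (rule sum.swap)
      also have "\<dots> = (\<Sum>p\<in>{a<..n}. 1 / real p ^ l * star_sum (Suc p) n (m # js))"
        using less.hyps[of "m # js"] by (simp add: ls)
      \<comment> \<open>At each \<open>p\<close> the next variable is either larger than
        \<open>p\<close> or equal to \<open>p\<close>; \<open>star_sum_Suc\<close> merges the two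
        cases.\<close>
      also have "\<dots> + star_sum (Suc a) n ((l + m) # js) =
          (\<Sum>p\<in>{Suc a..n}. 1 / real p ^ l * star_sum (Suc p) n (m # js) +
             1 / real p ^ l * (1 / real p ^ m * star_sum p n js))"
        by (simp add: sum.distrib power_add atLeastSucAtMost_greaterThanAtMost)
      also have "\<dots> = star_sum (Suc a) n ls"
        unfolding ls star_sum.simps(2)[of "Suc a" n l]
        by (intro sum.cong refl) (simp add: star_sum_Suc distrib_left del: star_sum.simps)
      finally show ?thesis .
    qed
  qed (use less.prems in simp)
qed


subsection \<open>Multiple zeta values as single series\<close>

lemma sum_inverse_sqrt_le: "(\<Sum>m\<in>{0<..n}. 1 / sqrt (real m)) \<le> 2 * sqrt (real n)"
proof (induction n)
  case (Suc n)
  define x y where "x = sqrt (real n)" and "y = sqrt (real (Suc n))"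
  have "0 < y" "y\<^sup>2 = x\<^sup>2 + 1" by (simp_all add: x_def y_def)
  \<comment> \<open>With \<open>y^2 = x^2 + 1\<close> this amounts to
    \<open>1 / y <= 2 * (y - x)\<close>, which telescopes.\<close>
  moreover have "2 * x * y \<le> x\<^sup>2 + y\<^sup>2" by (rule sum_squares_bound)
  ultimately have "1 / y + 2 * x \<le> 2 * y"
    by (simp add: field_simps power2_eq_square)
  moreover have "{0<..Suc n} = insert (Suc n) {0<..n}" by auto
  ultimately show ?case using Suc by (simp add: x_def y_def)
qed simp

text \<open>The worst exponent is 1. A bound of order \<open>sqrt m\<close> reproduces itself under
  division by \<open>m\<close> and summation, at the cost of a factor 2 per entry. The maximum with
  1 covers the empty index at \<open>n = 0\<close>.\<close>

lemma strict_sum_le: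
  assumes "is_index ks"
  shows "strict_sum 0 n ks \<le> 2 ^ length ks * max 1 (sqrt (real n))"
  using assms
proof (induction ks arbitrary: n rule: rev_induct)
  case (snoc k ks)
  have k: "1 \<le> k" and ks: "is_index ks" using snoc.prems by auto
  have "strict_sum 0 m ks / real m ^ k \<le> 2 ^ length ks * (1 / sqrt (real m))"
    if "m \<in> {0<..<n}" for m
  proof -
    have m: "1 \<le> real m" using that by simp
    then have s: "1 \<le> sqrt (real m)" by simp
    have "strict_sum 0 m ks / real m ^ k \<le> strict_sum 0 m ks / real m"
      using m k power_increasing[of 1 k "real m"] strict_sum_nonneg[of 0 m ks]
      by (intro divide_left_mono) (auto intro!: mult_pos_pos)
    also have "\<dots> \<le> 2 ^ length ks * sqrt (real m) / real m"
      using snoc.IH[OF ks, of m] s m by (intro divide_right_mono) (auto simp: max_def)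
    also have "\<dots> = 2 ^ length ks * (1 / sqrt (real m))"
      using m real_sqrt_mult_self[of "real m"] by (simp add: field_simps)
    finally show ?thesis .
  qed
  then have "strict_sum 0 n (ks @ [k]) \<le> (\<Sum>m\<in>{0<..<n}. 2 ^ length ks * (1 / sqrt (real m)))"
    unfolding strict_sum_snoc by (rule sum_mono)
  also have "\<dots> = 2 ^ length ks * (\<Sum>m\<in>{0<..<n}. 1 / sqrt (real m))"
    by (rule sum_distrib_left[symmetric])
  also have "\<dots> \<le> 2 ^ length ks * (\<Sum>m\<in>{0<..n}. 1 / sqrt (real m))"
    by (intro mult_left_mono sum_mono2) auto
  also have "\<dots> \<le> 2 ^ length ks * (2 * sqrt (real n))"
    by (intro mult_left_mono sum_inverse_sqrt_le) auto
  also have "\<dots> \<le> 2 ^ length (ks @ [k]) * max 1 (sqrt (real n))"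
    by simp
  finally show ?case .
qed simp

text \<open>An exponent of at least 2 at the largest variable leaves at most a multiple of
  \<open>sqrt n / n^2\<close>, and \<open>-3/2 < -1\<close>.\<close>

lemma summable_last_sum:
  assumes "is_index ks" "2 \<le> k"
  shows "summable (\<lambda>n. last_sum 0 n (ks @ [k]))"
proof (rule summable_comparison_test)
  show "summable (\<lambda>n. 2 ^ length ks * real n powr (-3/2))"
    by (intro summable_mult) (simp add: summable_real_powr_iff)
  have "norm (last_sum 0 n (ks @ [k])) \<le> 2 ^ length ks * real n powr (-3/2)" if "1 \<le> n" for n
  proof -
    have n: "1 \<le> real n" using that by simp
    have "last_sum 0 n (ks @ [k]) = strict_sum 0 n ks / real n ^ k"
      using that by (intro last_sum_snoc) simp
    also have "\<dots> \<le> strict_sum 0 n ks / real n ^ 2"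
      using n assms(2) strict_sum_nonneg[of 0 n ks]
      by (intro divide_left_mono power_increasing) (auto intro!: mult_pos_pos)
    also have "\<dots> \<le> 2 ^ length ks * sqrt (real n) / real n ^ 2"
      using strict_sum_le[OF assms(1), of n] n by (intro divide_right_mono) (auto simp: max_def)
    also have "\<dots> = 2 ^ length ks * (real n powr (1/2) / real n powr 2)"
      using n by (simp add: powr_half_sqrt powr_numeral)
    also have "real n powr (1/2) / real n powr 2 = real n powr (-3/2)"
      by (subst powr_diff[symmetric]) simp
    finally show ?thesis using last_sum_nonneg[of 0 n "ks @ [k]"] by simp
  qed
  then show "\<exists>N. \<forall>n\<ge>N. norm (last_sum 0 n (ks @ [k])) \<le> 2 ^ length ks * real n powr (-3/2)"
    by blast
qed

section \<open>Grouping a multiple zeta series by its largest variable\<close>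

definition increasing_lists :: "nat \<Rightarrow> nat \<Rightarrow> nat \<Rightarrow> nat list set"
  where "increasing_lists a n r = {ms. length ms = r \<and> sorted_wrt (<) ms \<and> (\<forall>m\<in>set ms. a < m \<and> m < n)}"

lemma finite_increasing_lists: "finite (increasing_lists a n r)"
  by (rule finite_subset[OF _ finite_lists_length_eq[of "{a<..<n}" r]])
    (auto simp: increasing_lists_def)

lemma increasing_lists_0: "increasing_lists a n 0 = {[]}"
  by (auto simp: increasing_lists_def)

lemma increasing_lists_Suc:
  "increasing_lists a n (Suc r) = (\<lambda>(m, ms). m # ms) ` (SIGMA m:{a<..<n}. increasing_lists m n r)"
proof (intro equalityI subsetI)
  fix ms
  assume "ms \<in> increasing_lists a n (Suc r)"
  then show "ms \<in> (\<lambda>(m, ms). m # ms) ` (SIGMA m:{a<..<n}. increasing_lists m n r)"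
    by (cases ms) (auto simp: increasing_lists_def image_iff)
next
  fix ms
  assume "ms \<in> (\<lambda>(m, ms). m # ms) ` (SIGMA m:{a<..<n}. increasing_lists m n r)"
  then obtain m js where ms: "ms = m # js" "a < m" "m < n" "length js = r" "sorted_wrt (<) js"
    and js: "\<And>j. j \<in> set js \<Longrightarrow> m < j \<and> j < n"
    by (auto simp: increasing_lists_def)
  have "a < j" if "j \<in> set js" for j using js[OF that] ms(2) by simp
  with ms js show "ms \<in> increasing_lists a n (Suc r)" by (simp add: increasing_lists_def)
qed

lemma strict_sum_eq_sum_lists:
  "strict_sum a n ks =
    (\<Sum>ms\<in>increasing_lists a n (length ks). \<Prod>i<length ks. 1 / real (ms ! i) ^ (ks ! i))"
proof (induction ks arbitrary: a)
  case (Cons k ks)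
  have inj: "inj_on (\<lambda>(m, ms). m # ms) A" for A :: "(nat \<times> nat list) set"
    by (auto simp: inj_on_def)
  have "(\<Sum>ms\<in>increasing_lists a n (length (k # ks)).
        \<Prod>i<length (k # ks). 1 / real (ms ! i) ^ ((k # ks) ! i)) =
      (\<Sum>(m, ms)\<in>(SIGMA m:{a<..<n}. increasing_lists m n (length ks)).
        1 / real m ^ k * (\<Prod>i<length ks. 1 / real (ms ! i) ^ (ks ! i)))"
    unfolding list.size add_Suc_right add_0_right increasing_lists_Suc sum.reindex[OF inj]
    by (intro sum.cong) (auto simp: prod.lessThan_Suc_shift simp del: prod.lessThan_Suc)
  also have "\<dots> = strict_sum a n (k # ks)"
    by (simp add: Cons sum_distrib_left sum.Sigma finite_increasing_lists)
  finally show ?case by (rule sym)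
qed (simp add: increasing_lists_0)

text \<open>All terms are nonnegative, so the unordered sum may be grouped by the largest entry
  \<open>n\<close>. Each group is finite and equals \<open>last_sum\<close>, which reduces
  summability to a single series.\<close>

lemma zeta_index_snoc:
  assumes "is_index ks" "2 \<le> k"
  shows "zeta_index (ks @ [k]) = suminf (\<lambda>n. last_sum 0 n (ks @ [k]))"
proof -
  define r where "r = length ks"
  define f where "f ms = (\<Prod>i<Suc r. 1 / real (ms ! i) ^ ((ks @ [k]) ! i))" for ms :: "nat list"
  define S where "S = (SIGMA n:{0<..}. increasing_lists 0 n r)"
  have image: "{ms :: nat list. length ms = Suc r \<and> sorted_wrt (<) ms \<and> (\<forall>m\<in>set ms. 0 < m)} =
      (\<lambda>(n, ms). ms @ [n]) ` S"
  proof (intro equalityI subsetI)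
    fix ms :: "nat list"
    assume ms: "ms \<in> {ms. length ms = Suc r \<and> sorted_wrt (<) ms \<and> (\<forall>m\<in>set ms. 0 < m)}"
    then obtain js n where "ms = js @ [n]" by (cases ms rule: rev_cases) auto
    with ms have "ms = (\<lambda>(n, ms). ms @ [n]) (n, js)" "(n, js) \<in> S"
      by (auto simp: S_def increasing_lists_def sorted_wrt_append)
    then show "ms \<in> (\<lambda>(n, ms). ms @ [n]) ` S" by (rule image_eqI)
  qed (auto simp: S_def increasing_lists_def sorted_wrt_append)
  have inj: "inj_on (\<lambda>(n, ms). ms @ [n]) S"
    by (auto simp: inj_on_def)
  have inner: "((\<lambda>ms. f (ms @ [n])) has_sum last_sum 0 n (ks @ [k])) (increasing_lists 0 n r)"
    if "n \<in> {0<..}" for n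
  proof -
    have "f (ms @ [n]) = (\<Prod>i<r. 1 / real (ms ! i) ^ (ks ! i)) * (1 / real n ^ k)"
      if "ms \<in> increasing_lists 0 n r" for ms
      using that by (simp add: f_def increasing_lists_def r_def nth_append)
    then have "(\<Sum>ms\<in>increasing_lists 0 n r. f (ms @ [n])) =
        (\<Sum>ms\<in>increasing_lists 0 n r. (\<Prod>i<r. 1 / real (ms ! i) ^ (ks ! i)) * (1 / real n ^ k))"
      by (intro sum.cong) auto
    also have "\<dots> = strict_sum 0 n ks * (1 / real n ^ k)"
      by (simp only: strict_sum_eq_sum_lists r_def sum_distrib_right)
    also have "\<dots> = last_sum 0 n (ks @ [k])"
      using that by (simp add: last_sum_snoc)
    finally show ?thesis
      using has_sum_finite[OF finite_increasing_lists[of 0 n r], of "\<lambda>ms. f (ms @ [n])"] by simp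
  qed
  have sums: "((\<lambda>n. last_sum 0 n (ks @ [k])) has_sum suminf (\<lambda>n. last_sum 0 n (ks @ [k]))) UNIV"
    using summable_last_sum[OF assms]
    by (intro norm_summable_imp_has_sum summable_sums) (simp_all add: last_sum_nonneg)
  \<comment> \<open>\<open>n = 0\<close> is not a possible largest entry, but the series over all
    naturals gains nothing there, since \<open>last_sum 0 0\<close> vanishes on a non-empty
    index.\<close>
  have outer: "((\<lambda>n. last_sum 0 n (ks @ [k])) has_sum suminf (\<lambda>n. last_sum 0 n (ks @ [k]))) {0<..}"
    by (rule has_sum_cong_neutral[THEN iffD1, OF _ _ _ sums]) (auto simp: last_sum_diag)
  have nonneg: "0 \<le> f ms" for ms
    unfolding f_def by (intro prod_nonneg) simp
  have "((\<lambda>(n, ms). f (ms @ [n])) has_sum suminf (\<lambda>n. last_sum 0 n (ks @ [k]))) S"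
    unfolding S_def
  proof (rule has_sum_SigmaI)
    show "(\<lambda>(n, ms). f (ms @ [n])) summable_on (SIGMA n:{0<..}. increasing_lists 0 n r)"
    proof (rule summable_on_SigmaI)
      show "(\<lambda>n. last_sum 0 n (ks @ [k])) summable_on {0<..}"
        using outer by (rule has_sum_imp_summable)
    qed (use inner nonneg in simp_all)
  qed (use inner outer in simp_all)
  then have "(f has_sum suminf (\<lambda>n. last_sum 0 n (ks @ [k]))) ((\<lambda>(n, ms). ms @ [n]) ` S)"
    unfolding has_sum_reindex[OF inj] by (simp only: o_def split_def)
  moreover have "zeta_index (ks @ [k]) = infsum f ((\<lambda>(n, ms). ms @ [n]) ` S)"
    unfolding image[symmetric] zeta_index_def f_def r_def by (simp only: length_append_singleton)
  ultimately show ?thesis by (simp add: infsumI)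
qed


subsection \<open>The series side\<close>

text \<open>Cancellation can shrink the support of a sum, so additivity is checked on a common
  finite set containing the supports.\<close>

lemma zeta_superset:
  assumes "finite S" "Poly_Mapping.keys p \<subseteq> S"
  shows "zeta p = (\<Sum>w\<in>S. of_rat (Poly_Mapping.lookup p w) * zeta_index (index_of w))"
  unfolding zeta_def using assms
  by (intro sum.mono_neutral_left) (auto simp: in_keys_iff)

lemma zeta_0: "zeta 0 = 0"
  by (simp add: zeta_def)

lemma zeta_add: "zeta (p + q) = zeta p + zeta q"
proof -
  let ?S = "Poly_Mapping.keys p \<union> Poly_Mapping.keys q"
  have "zeta (p + q) =
      (\<Sum>w\<in>?S. of_rat (Poly_Mapping.lookup (p + q) w) * zeta_index (index_of w))"
    using Poly_Mapping.keys_add[of p q] by (intro zeta_superset) auto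
  also have "\<dots> = zeta p + zeta q"
    by (simp add: zeta_superset[of ?S] lookup_add of_rat_add distrib_right sum.distrib)
  finally show ?thesis .
qed

lemma zeta_sum: "zeta (\<Sum>i\<in>I. p i) = (\<Sum>i\<in>I. zeta (p i))"
  by (induction I rule: infinite_finite_induct) (simp_all add: zeta_0 zeta_add)

lemma sums_zeta_idx_snoc:
  assumes "list_all is_index jss" "2 \<le> k"
  shows "(\<lambda>n. \<Sum>js\<leftarrow>jss. last_sum 0 n (js @ [k])) sums zeta (sum_list (map idx jss) * ek k)"
  using assms(1)
proof (induction jss)
  case (Cons js jss)
  have "zeta (idx js * ek k) = zeta_index (js @ [k])"
    using Cons.prems assms(2) zeta_idx[of "js @ [k]"] by (simp add: idx_append idx_Cons)
  moreover have "(\<lambda>n. last_sum 0 n (js @ [k])) sums zeta_index (js @ [k])"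
    using Cons.prems assms(2) by (simp add: zeta_index_snoc summable_last_sum summable_sums)
  ultimately show ?case
    using Cons by (simp add: distrib_right zeta_add sums_add)
qed (simp add: zeta_0)

text \<open>The circled product identifies the two largest variables, both equal to
  \<open>n\<close>, which adds their exponents; below \<open>n\<close> the remaining variables
  multiply by the harmonic product rule \<open>strict_sum_mult\<close>.\<close>

lemma sums_zeta_circ_harm_index:
  assumes "is_index ks" "ks \<noteq> []" "is_index js" "js \<noteq> []"
  shows "(\<lambda>n. last_sum 0 n ks * last_sum 0 n js) sums zeta (circ_harm_index ks js)"
proof -
  obtain ks' k where ks: "ks = ks' @ [k]" using assms(2) by (metis rev_exhaust)
  obtain js' j where js: "js = js' @ [j]" using assms(4) by (metis rev_exhaust)
  have eq: "circ_harm_index ks js = sum_list (map idx (stuffle ks' js')) * ek (k + j)"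
    using assms by (simp add: circ_harm_index_def ks js harm_bilinear(7) harm_index_stuffle)
  have "(\<Sum>is\<leftarrow>stuffle ks' js'. last_sum 0 n (is @ [k + j])) = last_sum 0 n ks * last_sum 0 n js"
    for n
  proof (cases "n = 0")
    case True
    then show ?thesis by (simp add: last_sum_diag ks)
  next
    case False
    have "(\<Sum>is\<leftarrow>stuffle ks' js'. last_sum 0 n (is @ [k + j])) =
        (\<Sum>is\<leftarrow>stuffle ks' js'. strict_sum 0 n is * (1 / real n ^ (k + j)))"
      using False by (simp add: last_sum_snoc)
    also have "\<dots> = strict_sum 0 n ks' * strict_sum 0 n js' * (1 / real n ^ (k + j))"
      by (simp only: sum_list_mult_const strict_sum_mult)
    also have "\<dots> = last_sum 0 n ks * last_sum 0 n js"
      using False by (simp add: ks js last_sum_snoc power_add)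
    finally show ?thesis .
  qed
  moreover have "list_all is_index (stuffle ks' js')"
    using assms by (intro is_index_stuffle) (simp_all add: ks js)
  moreover have "2 \<le> k + j" using assms by (simp add: ks js)
  ultimately show ?thesis
    using sums_zeta_idx_snoc[of "stuffle ks' js'" "k + j"] by (simp add: eq)
qed

text \<open>Only the second factor depends on the choice of separators, so the sum over them can be
  carried out at fixed \<open>n\<close>.\<close>

lemma sums_zeta_circ_harm_star:
  assumes "is_index ks" "ks \<noteq> []" "is_index ls" "ls \<noteq> []"
  shows "(\<lambda>n. last_sum 0 n ks * star_sum 1 n ls) sums zeta (circ_harm (idx ks) (star ls))"
proof -
  have "circ_harm (idx ks) (star ls) =
      (\<Sum>cs | length cs = length ls - 1. circ_harm_index ks (fill ls cs))"
    using assms fill_index[of ls] by (simp add: circ_harm_def star_def lin_ext_sum)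
  then have "zeta (circ_harm (idx ks) (star ls)) =
      (\<Sum>cs | length cs = length ls - 1. zeta (circ_harm_index ks (fill ls cs)))"
    by (simp add: zeta_sum)
  moreover have "(\<lambda>n. \<Sum>cs | length cs = length ls - 1. last_sum 0 n ks * last_sum 0 n (fill ls cs))
      sums (\<Sum>cs | length cs = length ls - 1. zeta (circ_harm_index ks (fill ls cs)))"
    using assms fill_index[of ls] by (intro sums_sum sums_zeta_circ_harm_index) auto
  moreover have "(\<Sum>cs | length cs = length ls - 1. last_sum 0 n ks * last_sum 0 n (fill ls cs)) =
      last_sum 0 n ks * star_sum 1 n ls" for n
    using sum_fill_last_sum[OF assms(4), of 0 n] by (simp flip: sum_distrib_left)
  ultimately show ?thesis by simp
qed


section \<open>Linear extensions of zigzag paths\<close>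

text \<open>
  A zigzag path is given in reverse order, each node being preceded by a flag that tells whether
  the path goes up to it from the next entry of the list. The flag of the last entry is irrelevant.
\<close>

fun path_rel :: "(bool \<times> 'a) list \<Rightarrow> 'a rel"
  where
    "path_rel ((d, y) # (e, x) # p) = insert (if d then (x, y) else (y, x)) (path_rel ((e, x) # p))"
  | "path_rel _ = {}"

text \<open>
  A linear extension is recorded as a zipper focused at the head \<open>x\<close> of the list: the pair
  \<open>(u, v)\<close> stands for \<open>rev u @ x # v\<close>.
\<close>

fun zippers :: "(bool \<times> 'a) list \<Rightarrow> ('a list \<times> 'a list) set"
  where
    "zippers [] = {}"
  | "zippers [(d, x)] = {([], [])}"
  | "zippers ((True, y) # (e, x) # p) =
      (\<lambda>((u, v), i). (rev (take i v) @ x # u, drop i v)) `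
        (SIGMA (u, v):zippers ((e, x) # p). {..length v})"
  | "zippers ((False, y) # (e, x) # p) =
      (\<lambda>((u, v), i). (drop i u, rev (take i u) @ x # v)) `
        (SIGMA (u, v):zippers ((e, x) # p). {..length u})"

text \<open>Precedence by cutting the list instead of comparing positions, so that inserting or
  removing another entry shifts nothing.\<close>

definition before :: "'a list \<Rightarrow> 'a \<Rightarrow> 'a \<Rightarrow> bool"
  where "before xs a b \<longleftrightarrow> (\<exists>us vs. xs = us @ vs \<and> a \<in> set us \<and> b \<in> set vs)"

lemma before_insert: "before (us @ vs) a b \<Longrightarrow> before (us @ y # vs) a b"
proof -
  assume "before (us @ vs) a b"
  then obtain s t where st: "us @ vs = s @ t" "a \<in> set s" "b \<in> set t"
    by (auto simp: before_def)
  then consider r where "us = s @ r" "r @ vs = t" | r where "us @ r = s" "vs = r @ t"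
    by (auto simp: append_eq_append_conv2)
  then show ?thesis
  proof cases
    case 1
    then show ?thesis
      unfolding before_def using st by (intro exI[of _ s] exI[of _ "r @ y # vs"]) auto
  next
    case 2
    then show ?thesis
      unfolding before_def using st by (intro exI[of _ "us @ y # r"] exI[of _ t]) auto
  qed
qed

lemma before_remove: "before (us @ y # vs) a b \<Longrightarrow> a \<noteq> y \<Longrightarrow> b \<noteq> y \<Longrightarrow> before (us @ vs) a b"
proof -
  assume ab: "before (us @ y # vs) a b" "a \<noteq> y" "b \<noteq> y"
  then obtain s t where st: "us @ y # vs = s @ t" "a \<in> set s" "b \<in> set t"
    by (auto simp: before_def)
  then consider r where "us = s @ r" "r @ y # vs = t" | r where "s = us @ y # r" "vs = r @ t"
    by (auto simp: append_eq_append_conv2 Cons_eq_append_conv)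
  then show ?thesis
  proof cases
    case 1
    then show ?thesis
      unfolding before_def using st ab by (intro exI[of _ s] exI[of _ "r @ vs"]) auto
  next
    case 2
    then show ?thesis
      unfolding before_def using st ab by (intro exI[of _ "us @ r"] exI[of _ t]) auto
  qed
qed

lemma before_focus:
  assumes "distinct (us @ y # vs)"
  shows "before (us @ y # vs) x y \<longleftrightarrow> x \<in> set us" "before (us @ y # vs) y x \<longleftrightarrow> x \<in> set vs"
proof -
  show "before (us @ y # vs) x y \<longleftrightarrow> x \<in> set us"
  proof
    assume "before (us @ y # vs) x y"
    then obtain s t where st: "us @ y # vs = s @ t" "x \<in> set s" "y \<in> set t"
      by (auto simp: before_def)
    then show "x \<in> set us"
      using assms by (auto simp: append_eq_append_conv2 Cons_eq_append_conv)
  next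
    assume "x \<in> set us"
    then show "before (us @ y # vs) x y"
      unfolding before_def by (intro exI[of _ us] exI[of _ "y # vs"]) auto
  qed
  show "before (us @ y # vs) y x \<longleftrightarrow> x \<in> set vs"
  proof
    assume "before (us @ y # vs) y x"
    then obtain s t where st: "us @ y # vs = s @ t" "y \<in> set s" "x \<in> set t"
      by (auto simp: before_def)
    then show "x \<in> set vs"
      using assms by (auto simp: append_eq_append_conv2 Cons_eq_append_conv)
  next
    assume "x \<in> set vs"
    then show "before (us @ y # vs) y x"
      unfolding before_def by (intro exI[of _ "us @ [y]"] exI[of _ vs]) auto
  qed
qed

text \<open>Only the generating pairs are tested. This allows \<open>path_rel\<close> to be used
  without its transitive closure.\<close>

definition extends :: "'a set \<Rightarrow> 'a rel \<Rightarrow> 'a list \<Rightarrow> bool"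
  where "extends X r xs \<longleftrightarrow> distinct xs \<and> set xs = X \<and> (\<forall>(a, b)\<in>r. before xs a b)"

lemma path_rel_subset: "path_rel p \<subseteq> snd ` set p \<times> snd ` set p"
  by (induction p rule: path_rel.induct) auto

text \<open>The new element \<open>y\<close> is related only to \<open>x\<close>, so the remaining
  constraints survive its removal and the sole new condition is the side of \<open>y\<close> on
  which \<open>x\<close> stands.\<close>

lemma extends_insert_iff:
  assumes "y \<notin> X" "r \<subseteq> X \<times> X" "x \<in> X"
  shows "extends (insert y X) (insert (x, y) r) (us @ y # vs) \<longleftrightarrow> extends X r (us @ vs) \<and> x \<in> set us"
    and "extends (insert y X) (insert (y, x) r) (us @ y # vs) \<longleftrightarrow> extends X r (us @ vs) \<and> x \<in> set vs"
proof -
  have "(distinct (us @ y # vs) \<and> set (us @ y # vs) = insert y X) \<longleftrightarrow>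
      (distinct (us @ vs) \<and> set (us @ vs) = X)"
    using assms(1) by (auto simp: insert_ident)
  moreover have "(\<forall>(a, b)\<in>r. before (us @ y # vs) a b) \<longleftrightarrow> (\<forall>(a, b)\<in>r. before (us @ vs) a b)"
    using assms(1,2) by (blast intro: before_insert before_remove)
  ultimately show
    "extends (insert y X) (insert (x, y) r) (us @ y # vs) \<longleftrightarrow> extends X r (us @ vs) \<and> x \<in> set us"
    "extends (insert y X) (insert (y, x) r) (us @ y # vs) \<longleftrightarrow> extends X r (us @ vs) \<and> x \<in> set vs"
    using before_focus[of us y vs x] unfolding extends_def by auto
qed

text \<open>Lengthening the path moves the focus to a new node that may stand anywhere on one side
  of the old focus; all entries passed on the way change to the other half of the zipper.\<close>

lemma zippers_iff:
  assumes "distinct (map snd ((d, x) # p))"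
  shows "(u, v) \<in> zippers ((d, x) # p) \<longleftrightarrow>
    extends (snd ` set ((d, x) # p)) (path_rel ((d, x) # p)) (rev u @ x # v)"
  using assms
proof (induction p arbitrary: d x u v)
  case Nil
  have "u = [] \<and> v = []" if "extends {x} {} (rev u @ x # v)"
  proof -
    have *: "set u \<union> set v \<subseteq> {x}" "x \<notin> set u" "x \<notin> set v"
      using that by (auto simp: extends_def)
    have "u = []" using *(1,2) by (cases u) auto
    moreover have "v = []" using *(1,3) by (cases v) auto
    ultimately show ?thesis by simp
  qed
  moreover have "extends {x} {} [x]" by (simp add: extends_def)
  ultimately show ?case by auto
next
  case (Cons q p)
  obtain e z where q: "q = (e, z)" by (cases q)
  define X r where "X = snd ` set ((e, z) # p)" and "r = path_rel ((e, z) # p)"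
  have IH: "(u, v) \<in> zippers ((e, z) # p) \<longleftrightarrow> extends X r (rev u @ z # v)" for u v
    unfolding X_def r_def using Cons.prems q by (intro Cons.IH) simp
  have X: "x \<notin> X" "r \<subseteq> X \<times> X" "z \<in> X"
    unfolding X_def r_def using Cons.prems q path_rel_subset[of "(e, z) # p"] by auto
  have set: "snd ` set ((d, x) # q # p) = insert x X" by (simp add: X_def q)
  show ?case
  proof (cases d)
    case True
    \<comment> \<open>\<open>w\<close> is the stretch strictly between the old focus
      \<open>z\<close> and the new focus \<open>x\<close>. It is reversed in \<open>u\<close>
      because the first half is stored from the focus outwards.\<close>
    have "(u, v) \<in> zippers ((d, x) # q # p) \<longleftrightarrow>
        (\<exists>u' w. u = rev w @ z # u' \<and> (u', w @ v) \<in> zippers ((e, z) # p))"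
    proof
      assume "(u, v) \<in> zippers ((d, x) # q # p)"
      then obtain u' v' i where "(u', v') \<in> zippers ((e, z) # p)"
        "u = rev (take i v') @ z # u'" "v = drop i v'"
        by (auto simp: q True)
      then show "\<exists>u' w. u = rev w @ z # u' \<and> (u', w @ v) \<in> zippers ((e, z) # p)"
        by (intro exI[of _ u'] exI[of _ "take i v'"]) simp
    next
      assume "\<exists>u' w. u = rev w @ z # u' \<and> (u', w @ v) \<in> zippers ((e, z) # p)"
      then obtain u' w where w: "u = rev w @ z # u'" "(u', w @ v) \<in> zippers ((e, z) # p)" by blast
      show "(u, v) \<in> zippers ((d, x) # q # p)"
        unfolding q eqTrueI[OF True] zippers.simps
        by (rule image_eqI[where x = "((u', w @ v), length w)"]) (use w in auto)
    qed
    also have "\<dots> \<longleftrightarrow> extends X r (rev u @ v) \<and> z \<in> set (rev u)"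
    proof
      assume "extends X r (rev u @ v) \<and> z \<in> set (rev u)"
      moreover from this obtain a b where "u = a @ z # b" by (metis set_rev split_list)
      ultimately show "\<exists>u' w. u = rev w @ z # u' \<and> (u', w @ v) \<in> zippers ((e, z) # p)"
        by (intro exI[of _ b] exI[of _ "rev a"]) (simp add: IH)
    qed (auto simp: IH)
    also have "\<dots> \<longleftrightarrow> extends (insert x X) (insert (z, x) r) (rev u @ x # v)"
      using extends_insert_iff(1)[OF X] by simp
    finally show ?thesis unfolding set using True by (simp add: q r_def)
  next
    case False
    then have d: "d = False" by simp
    have "(u, v) \<in> zippers ((d, x) # q # p) \<longleftrightarrow>
        (\<exists>v' w. v = rev w @ z # v' \<and> (w @ u, v') \<in> zippers ((e, z) # p))"
    proof
      assume "(u, v) \<in> zippers ((d, x) # q # p)"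
      then obtain u' v' i where "(u', v') \<in> zippers ((e, z) # p)"
        "v = rev (take i u') @ z # v'" "u = drop i u'"
        by (auto simp: q False)
      then show "\<exists>v' w. v = rev w @ z # v' \<and> (w @ u, v') \<in> zippers ((e, z) # p)"
        by (intro exI[of _ v'] exI[of _ "take i u'"]) simp
    next
      assume "\<exists>v' w. v = rev w @ z # v' \<and> (w @ u, v') \<in> zippers ((e, z) # p)"
      then obtain v' w where w: "v = rev w @ z # v'" "(w @ u, v') \<in> zippers ((e, z) # p)" by blast
      show "(u, v) \<in> zippers ((d, x) # q # p)"
        unfolding q d zippers.simps
        by (rule image_eqI[where x = "((w @ u, v'), length w)"]) (use w in auto)
    qed
    also have "\<dots> \<longleftrightarrow> extends X r (rev u @ v) \<and> z \<in> set v"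
    proof
      assume "extends X r (rev u @ v) \<and> z \<in> set v"
      moreover from this obtain a b where "v = a @ z # b" by (metis split_list)
      ultimately show "\<exists>v' w. v = rev w @ z # v' \<and> (w @ u, v') \<in> zippers ((e, z) # p)"
        by (intro exI[of _ b] exI[of _ "rev a"]) (simp add: IH)
    qed (auto simp: IH)
    also have "\<dots> \<longleftrightarrow> extends (insert x X) (insert (x, z) r) (rev u @ x # v)"
      using extends_insert_iff(2)[OF X] by simp
    finally show ?thesis unfolding set using False by (simp add: q r_def)
  qed
qed

lemma before_iff_nth:
  assumes "distinct xs" "a \<noteq> b"
  shows "before xs a b \<longleftrightarrow> (\<exists>i j. i < j \<and> j < length xs \<and> xs ! i = a \<and> xs ! j = b)"
proof
  assume "before xs a b"
  then obtain us vs where xs: "xs = us @ vs" "a \<in> set us" "b \<in> set vs" by (auto simp: before_def)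
  then obtain i j where "i < length us" "us ! i = a" "j < length vs" "vs ! j = b"
    by (auto simp: in_set_conv_nth)
  then show "\<exists>i j. i < j \<and> j < length xs \<and> xs ! i = a \<and> xs ! j = b"
    using xs by (intro exI[of _ i] exI[of _ "length us + j"]) (simp add: nth_append)
next
  assume "\<exists>i j. i < j \<and> j < length xs \<and> xs ! i = a \<and> xs ! j = b"
  then obtain i j where ij: "i < j" "j < length xs" "xs ! i = a" "xs ! j = b" by blast
  have "a \<in> set (take j xs)" "b \<in> set (drop j xs)"
    using ij by (auto simp: in_set_conv_nth intro: exI[of _ i] exI[of _ 0])
  then show "before xs a b"
    unfolding before_def by (intro exI[of _ "take j xs"] exI[of _ "drop j xs"]) simp
qed

text \<open>Positions increase along a chain of generating pairs, and distinctness makes them well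
  defined. Thus \<open>extends\<close> captures the linear extensions for the closure used in
  \<open>mu_order\<close>.\<close>

lemma linear_extensions_rtrancl:
  assumes "R \<subseteq> X \<times> X" "irrefl R"
  shows "linear_extensions X (R\<^sup>* \<inter> X \<times> X) = {xs. extends X R xs}"
proof (intro equalityI subsetI)
  fix xs
  assume "xs \<in> linear_extensions X (R\<^sup>* \<inter> X \<times> X)"
  then have xs: "distinct xs" "set xs = X"
    and le: "\<And>i j. i < length xs \<Longrightarrow> j < length xs \<Longrightarrow> (xs ! i, xs ! j) \<in> R\<^sup>* \<inter> X \<times> X \<Longrightarrow>
      xs ! i \<noteq> xs ! j \<Longrightarrow> i < j"
    by (auto simp: linear_extensions_def)
  have "before xs a b" if "(a, b) \<in> R" for a b
  proof -
    have ab: "a \<in> X" "b \<in> X" "a \<noteq> b" using that assms by (auto simp: irrefl_def)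
    then obtain i j where "i < length xs" "xs ! i = a" "j < length xs" "xs ! j = b"
      unfolding xs(2)[symmetric] by (auto simp: in_set_conv_nth)
    with le[of i j] that ab show ?thesis
      unfolding before_iff_nth[OF xs(1) ab(3)] by blast
  qed
  with xs show "xs \<in> {xs. extends X R xs}" by (auto simp: extends_def)
next
  fix xs
  assume "xs \<in> {xs. extends X R xs}"
  then have xs: "distinct xs" "set xs = X" and R: "\<And>a b. (a, b) \<in> R \<Longrightarrow> before xs a b"
    by (auto simp: extends_def)
  have "\<exists>i j. i \<le> j \<and> j < length xs \<and> xs ! i = a \<and> xs ! j = b" if "(a, b) \<in> R\<^sup>*" "a \<in> X" for a b
    using that
  proof (induction rule: rtrancl_induct)
    case base
    then show ?case unfolding xs(2)[symmetric] by (auto simp: in_set_conv_nth)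
  next
    case (step b c)
    then obtain i j where ij: "i \<le> j" "j < length xs" "xs ! i = a" "xs ! j = b" by auto
    have "b \<noteq> c" using step assms by (auto simp: irrefl_def)
    then obtain i' j' where "i' < j'" "j' < length xs" "xs ! i' = b" "xs ! j' = c"
      using R[OF step(2)] before_iff_nth[OF xs(1)] by blast
    moreover from this ij have "i' = j"
      using nth_eq_iff_index_eq[OF xs(1), of i' j] by simp
    ultimately show ?case using ij by (intro exI[of _ i] exI[of _ j']) simp
  qed
  then have "i < j" if "i < length xs" "j < length xs" "(xs ! i, xs ! j) \<in> R\<^sup>* \<inter> X \<times> X"
    "xs ! i \<noteq> xs ! j" for i j
    using that xs(1) by (metis IntE le_neq_implies_less mem_Sigma_iff nth_eq_iff_index_eq order_le_less_trans)
  with xs show "xs \<in> linear_extensions X (R\<^sup>* \<inter> X \<times> X)"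
    by (auto simp: linear_extensions_def)
qed

text \<open>The focus occurs only once in a linear extension, so the list determines where it is
  cut.\<close>

lemma bij_betw_zippers:
  assumes "distinct (map snd ((d, x) # p))"
  shows "bij_betw (\<lambda>(u, v). rev u @ x # v) (zippers ((d, x) # p))
    {xs. extends (snd ` set ((d, x) # p)) (path_rel ((d, x) # p)) xs}"
  unfolding bij_betw_def
proof
  show "inj_on (\<lambda>(u, v). rev u @ x # v) (zippers ((d, x) # p))"
  proof (rule inj_onI, clarify)
    fix u v u' v'
    assume "(u, v) \<in> zippers ((d, x) # p)" "(u', v') \<in> zippers ((d, x) # p)"
      and eq: "rev u @ x # v = rev u' @ x # v'"
    then have "distinct (rev u @ x # v)" "distinct (rev u' @ x # v')"
      unfolding zippers_iff[OF assms] extends_def by simp_all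
    then have "x \<notin> set (rev u)" "x \<notin> set (rev u')" "x \<notin> set v" by simp_all
    then have "rev u = rev u'" "v = v'" using eq by (auto simp: append_Cons_eq_iff)
    then show "u = u' \<and> v = v'" by simp
  qed
  show "(\<lambda>(u, v). rev u @ x # v) ` zippers ((d, x) # p) =
      {xs. extends (snd ` set ((d, x) # p)) (path_rel ((d, x) # p)) xs}"
  proof (intro equalityI subsetI)
    fix xs
    assume xs: "xs \<in> {xs. extends (snd ` set ((d, x) # p)) (path_rel ((d, x) # p)) xs}"
    then have "x \<in> set xs" by (simp add: extends_def)
    then obtain us vs where "xs = rev (rev us) @ x # vs" by (metis rev_rev_ident split_list)
    moreover from this xs have "(rev us, vs) \<in> zippers ((d, x) # p)"
      unfolding zippers_iff[OF assms] by simp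
    ultimately show "xs \<in> (\<lambda>(u, v). rev u @ x # v) ` zippers ((d, x) # p)" by force
  qed (use zippers_iff[OF assms] in auto)
qed


section \<open>Iterated integrals\<close>

text \<open>The cutoff to \<open>(0,1)\<close> is part of the form, so that all integrals can run
  over the whole real line.\<close>

definition omega :: "letter \<Rightarrow> real \<Rightarrow> ennreal"
  where "omega x t =
    (if 0 < t \<and> t < 1 then ennreal (case x of L0 \<Rightarrow> 1 / t | L1 \<Rightarrow> 1 / (1 - t)) else 0)"

text \<open>
  The head of the list carries the integration variable closest to \<open>t\<close>; so for \<open>R = (<)\<close> the word
  is read backwards.
\<close>

primrec iter_int :: "(real \<Rightarrow> real \<Rightarrow> bool) \<Rightarrow> letter list \<Rightarrow> real \<Rightarrow> ennreal"
  where
    "iter_int R [] t = 1"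
  | "iter_int R (x # w) t = (\<integral>\<^sup>+s. (if R s t then iter_int R w s * omega x s else 0) \<partial>lborel)"

lemma borel_measurable_omega [measurable]: "omega x \<in> borel_measurable borel"
proof (cases x)
  case L0
  show ?thesis unfolding omega_def L0 letter.case by measurable
next
  case L1
  show ?thesis unfolding omega_def L1 letter.case by measurable
qed

lemma borel_measurable_iter_int [measurable]:
  "iter_int (<) w \<in> borel_measurable borel" "iter_int (>) w \<in> borel_measurable borel"
proof -
  show "iter_int (<) w \<in> borel_measurable borel"
  proof (induction w)
    case (Cons x w)
    note [measurable] = Cons
    show ?case unfolding iter_int.simps by measurable
  qed simp
  show "iter_int (>) w \<in> borel_measurable borel"
  proof (induction w)
    case (Cons x w)
    note [measurable] = Cons
    show ?case unfolding iter_int.simps by measurable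
  qed simp
qed

text \<open>For \<open>R = (<)\<close> both \<open>t\<close> and the chain \<open>v\<close> lie
  above \<open>s\<close>. The summand \<open>i\<close> collects the case that exactly the first
  \<open>i\<close> variables of \<open>v\<close> lie between \<open>s\<close> and \<open>t\<close>:
  together with \<open>s\<close> they join the chain below \<open>t\<close>, in reverse order. This
  is the analytic form of inserting a node into a zipper; \<open>R\<close> and \<open>S\<close> stay
  symbolic so that one proof covers both directions.\<close>

lemma nn_integral_iter_int_split:
  assumes RS: "R = (<) \<and> S = (>) \<or> R = (>) \<and> S = (<)"
  shows "(\<integral>\<^sup>+s. (if R s t then iter_int R u s * omega x s * iter_int S v s else 0) \<partial>lborel) =
    (\<Sum>i\<le>length v. iter_int R (rev (take i v) @ x # u) t * iter_int S (drop i v) t)"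
proof (induction v arbitrary: u x)
  case Nil
  show ?case by (simp cong: if_cong)
next
  case (Cons z v)
  define F where "F s = iter_int R u s * omega x s" for s
  define G where "G r = iter_int S v r * omega z r" for r
  have [measurable]: "F \<in> borel_measurable borel" "G \<in> borel_measurable borel"
    unfolding F_def G_def using RS by auto
  have [measurable]: "Measurable.pred (borel \<Otimes>\<^sub>M borel) (\<lambda>(x, y). R x y)"
    "Measurable.pred borel (\<lambda>x. R x t)" "Measurable.pred borel (\<lambda>x. R s x)"
    "Measurable.pred borel (\<lambda>x. S x t)" for s
    using RS by auto
  have iter_R: "iter_int R (x # u) t = (\<integral>\<^sup>+s. (if R s t then F s else 0) \<partial>lborel)" for t
    unfolding F_def by simp
  have iter_S: "iter_int S (z # v) t = (\<integral>\<^sup>+r. (if S r t then G r else 0) \<partial>lborel)" for t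
    unfolding G_def by simp
  have SR: "S a b \<longleftrightarrow> R b a" for a b using RS by auto
  have total: "R s t \<Longrightarrow> r \<noteq> t \<Longrightarrow> R s r \<longleftrightarrow> R s r \<and> R r t \<or> R t r" for s r
    using RS by auto
  have trans: "R s r \<Longrightarrow> R r t \<Longrightarrow> R s t" and asym: "R r t \<Longrightarrow> \<not> R t r" for s r
    using RS by auto
  have inner: "iter_int S (z # v) s =
      (\<integral>\<^sup>+r. (if R s r \<and> R r t then G r else 0) \<partial>lborel) + iter_int S (z # v) t"
    if "R s t" for s
  proof -
    have "iter_int S (z # v) s = (\<integral>\<^sup>+r. (if R s r then G r else 0) \<partial>lborel)"
      by (simp only: iter_S SR)
    also have "\<dots> = (\<integral>\<^sup>+r. (if R s r \<and> R r t then G r else 0) + (if S r t then G r else 0) \<partial>lborel)"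
    proof (rule nn_integral_cong_AE)
      \<comment> \<open>The first variable \<open>r\<close> of the second chain lies before or
        beyond \<open>t\<close>; the tie \<open>r = t\<close> is a null set.\<close>
      show "AE r in lborel. (if R s r then G r else 0) =
          (if R s r \<and> R r t then G r else 0) + (if S r t then G r else 0)"
        using AE_lborel_singleton[of t]
      proof eventually_elim
        case (elim r)
        then show ?case using total[OF that, of r] asym[of r] by (auto simp: SR)
      qed
    qed
    also have "\<dots> = (\<integral>\<^sup>+r. (if R s r \<and> R r t then G r else 0) \<partial>lborel) + iter_int S (z # v) t"
      unfolding iter_S by (rule nn_integral_add) measurable
    finally show ?thesis .
  qed
  have "(\<integral>\<^sup>+s. (if R s t then iter_int R u s * omega x s * iter_int S (z # v) s else 0) \<partial>lborel) =
      (\<integral>\<^sup>+s. (\<integral>\<^sup>+r. (if R s r \<and> R r t then F s * G r else 0) \<partial>lborel) +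
         (if R s t then F s else 0) * iter_int S (z # v) t \<partial>lborel)"
  proof (rule nn_integral_cong)
    fix s
    show "(if R s t then iter_int R u s * omega x s * iter_int S (z # v) s else 0) =
        (\<integral>\<^sup>+r. (if R s r \<and> R r t then F s * G r else 0) \<partial>lborel) +
         (if R s t then F s else 0) * iter_int S (z # v) t"
    proof (cases "R s t")
      case True
      have "(\<integral>\<^sup>+r. (if R s r \<and> R r t then F s * G r else 0) \<partial>lborel) =
          (\<integral>\<^sup>+r. F s * (if R s r \<and> R r t then G r else 0) \<partial>lborel)"
        by (intro nn_integral_cong) simp
      also have "\<dots> = F s * (\<integral>\<^sup>+r. (if R s r \<and> R r t then G r else 0) \<partial>lborel)"
        by (rule nn_integral_cmult) measurable
      finally show ?thesis
        using True by (simp add: inner F_def distrib_left del: iter_int.simps)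
    next
      case False
      then have "\<not> (R s r \<and> R r t)" for r using trans by blast
      then have "(if R s r \<and> R r t then F s * G r else 0) = 0" for r by (rule if_not_P)
      with False show ?thesis by simp
    qed
  qed
  also have "\<dots> = (\<integral>\<^sup>+s. \<integral>\<^sup>+r. (if R s r \<and> R r t then F s * G r else 0) \<partial>lborel \<partial>lborel) +
      iter_int R (x # u) t * iter_int S (z # v) t"
    unfolding iter_R
    by (subst nn_integral_add, measurable) (subst nn_integral_multc, measurable)
  \<comment> \<open>After the exchange the inner integral over \<open>s\<close> is one step of the
    first chain, ending at \<open>r\<close>. So \<open>r\<close> takes over the role of
    \<open>s\<close>, with a shorter second chain.\<close>
  also have "(\<integral>\<^sup>+s. \<integral>\<^sup>+r. (if R s r \<and> R r t then F s * G r else 0) \<partial>lborel \<partial>lborel) =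
      (\<integral>\<^sup>+r. \<integral>\<^sup>+s. (if R s r \<and> R r t then F s * G r else 0) \<partial>lborel \<partial>lborel)"
    by (rule lborel_pair.Fubini') measurable
  also have "\<dots> = (\<integral>\<^sup>+r. (if R r t then iter_int R (x # u) r * omega z r * iter_int S v r else 0)
      \<partial>lborel)"
  proof (rule nn_integral_cong)
    fix r
    have "(\<integral>\<^sup>+s. (if R s r then F s * G r else 0) \<partial>lborel) =
        (\<integral>\<^sup>+s. (if R s r then F s else 0) * G r \<partial>lborel)"
      by (intro nn_integral_cong) simp
    also have "\<dots> = (\<integral>\<^sup>+s. (if R s r then F s else 0) \<partial>lborel) * G r"
      by (rule nn_integral_multc) measurable
    finally show "(\<integral>\<^sup>+s. (if R s r \<and> R r t then F s * G r else 0) \<partial>lborel) =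
        (if R r t then iter_int R (x # u) r * omega z r * iter_int S v r else 0)"
      unfolding iter_R by (simp add: G_def mult_ac)
  qed
  also have "\<dots> = (\<Sum>i\<le>length v. iter_int R (rev (take i v) @ z # x # u) t * iter_int S (drop i v) t)"
    by (rule Cons.IH)
  finally show ?case
    by (simp add: sum.atMost_Suc_shift add.commute del: sum.atMost_Suc iter_int.simps)
qed

lemma iter_int_greater_1: "w \<noteq> [] \<Longrightarrow> iter_int (>) w 1 = 0"
proof -
  assume "w \<noteq> []"
  then obtain x v where w: "w = x # v" by (cases w) auto
  have "(if s > 1 then iter_int (>) v s * omega x s else 0) = 0" for s :: real
    by (simp add: omega_def)
  then show ?thesis by (simp add: w)
qed

lemma nn_integral_omega_lessThan_1:
  "(\<integral>\<^sup>+s. f s * omega x s \<partial>lborel) = (\<integral>\<^sup>+s. (if s < 1 then f s * omega x s else 0) \<partial>lborel)"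
  by (intro nn_integral_cong) (simp add: omega_def)

text \<open>The splitting formula at \<open>t = 1\<close>: no variable lies above 1, so only the
  term with all of \<open>v\<close> below survives.\<close>

lemma nn_integral_iter_int_focus:
  "(\<integral>\<^sup>+s. iter_int (<) u s * omega x s * iter_int (>) v s \<partial>lborel) = iter_int (<) (rev v @ x # u) 1"
proof -
  have "(\<integral>\<^sup>+s. iter_int (<) u s * omega x s * iter_int (>) v s \<partial>lborel) =
      (\<integral>\<^sup>+s. (if s < 1 then iter_int (<) u s * omega x s * iter_int (>) v s else 0) \<partial>lborel)"
    by (intro nn_integral_cong) (simp add: omega_def)
  also have "\<dots> = (\<Sum>i\<le>length v.
      iter_int (<) (rev (take i v) @ x # u) 1 * iter_int (>) (drop i v) 1)"
    by (rule nn_integral_iter_int_split) simp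
  also have "\<dots> = (\<Sum>i\<le>length v. if i = length v then iter_int (<) (rev v @ x # u) 1 else 0)"
    by (intro sum.cong) (auto simp: iter_int_greater_1)
  finally show ?thesis by simp
qed


subsection \<open>Power series with coefficients in \<open>[0, \<infinity>]\<close>\<close>

definition pser :: "(nat \<Rightarrow> ennreal) \<Rightarrow> real \<Rightarrow> ennreal"
  where "pser a t = suminf (\<lambda>n. a n * ennreal (t ^ n))"

lemma borel_measurable_pser [measurable]: "pser a \<in> borel_measurable borel"
  unfolding pser_def by measurable

text \<open>Termwise integration with respect to counting measure, one of the two series being read
  as an integral.\<close>

lemma suminf_swap_ennreal:
  fixes f :: "nat \<Rightarrow> nat \<Rightarrow> ennreal"
  shows "suminf (\<lambda>i. suminf (\<lambda>j. f i j)) = suminf (\<lambda>j. suminf (\<lambda>i. f i j))"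
  using nn_integral_suminf[of "\<lambda>j i. f i j" "count_space UNIV"]
  by (simp add: nn_integral_count_space_nat)

lemma suminf_if_less_ennreal:
  fixes a :: "nat \<Rightarrow> ennreal"
  shows "suminf (\<lambda>m. if m < n then a m else 0) = (\<Sum>m<n. a m)"
  by (subst suminf_finite[of "{..<n}"]) auto

lemma nn_integral_power:
  fixes a b :: real
  assumes "0 \<le> a" "a \<le> b" "0 < n"
  shows "(\<integral>\<^sup>+s. (if a < s \<and> s < b then ennreal (s ^ (n - 1)) else 0) \<partial>lborel) =
    ennreal ((b ^ n - a ^ n) / real n)"
proof -
  have "(\<integral>\<^sup>+s. (if a < s \<and> s < b then ennreal (s ^ (n - 1)) else 0) \<partial>lborel) =
      (\<integral>\<^sup>+s. ennreal (s ^ (n - 1)) * indicator {a..b} s \<partial>lborel)"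
  proof (rule nn_integral_cong_AE)
    show "AE s in lborel. (if a < s \<and> s < b then ennreal (s ^ (n - 1)) else 0) =
        ennreal (s ^ (n - 1)) * indicator {a..b} s"
      using AE_lborel_singleton[of a] AE_lborel_singleton[of b]
      by eventually_elim (auto simp: indicator_def)
  qed
  also have "\<dots> = ennreal (b ^ n / real n - a ^ n / real n)"
  proof (rule nn_integral_FTC_Icc)
    fix s
    show "((\<lambda>s. s ^ n / real n) has_real_derivative s ^ (n - 1)) (at s)"
      using assms(3) by (auto intro!: derivative_eq_intros)
  qed (use assms in auto)
  finally show ?thesis by (simp add: diff_divide_distrib)
qed

text \<open>Termwise, \<open>s^n / s = s^(n-1)\<close> integrates to \<open>t^n / n\<close>. A
  constant term would give a divergent integral for \<open>t > 0\<close>, whereas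
  \<open>1 / real 0\<close> is 0; hence \<open>a 0 = 0\<close>.\<close>

lemma nn_integral_pser_L0:
  assumes "a 0 = 0" "0 \<le> t" "t \<le> 1"
  shows "(\<integral>\<^sup>+s. (if s < t then pser a s * omega L0 s else 0) \<partial>lborel) =
    pser (\<lambda>n. a n * ennreal (1 / real n)) t"
proof -
  have "(if s < t then pser a s * omega L0 s else 0) =
      suminf (\<lambda>n. a n * (if 0 < s \<and> s < t then ennreal (s ^ (n - 1)) else 0))" for s
  proof (cases "0 < s \<and> s < t")
    case True
    have "a n * ennreal (s ^ n) * ennreal (1 / s) = a n * ennreal (s ^ (n - 1))" for n
      using assms(1) True by (cases n) (simp_all add: mult.assoc flip: ennreal_mult')
    then show ?thesis
      using True assms by (simp add: pser_def omega_def flip: ennreal_suminf_multc)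
  qed (auto simp: omega_def)
  then have "(\<integral>\<^sup>+s. (if s < t then pser a s * omega L0 s else 0) \<partial>lborel) =
      suminf (\<lambda>n. a n * (\<integral>\<^sup>+s. (if 0 < s \<and> s < t then ennreal (s ^ (n - 1)) else 0) \<partial>lborel))"
    by (simp add: nn_integral_suminf nn_integral_cmult)
  also have "\<dots> = pser (\<lambda>n. a n * ennreal (1 / real n)) t"
    unfolding pser_def
  proof (rule suminf_cong)
    fix n
    show "a n * (\<integral>\<^sup>+s. (if 0 < s \<and> s < t then ennreal (s ^ (n - 1)) else 0) \<partial>lborel) =
        a n * ennreal (1 / real n) * ennreal (t ^ n)"
      using assms nn_integral_power[of 0 t n]
      by (cases "n = 0") (simp_all add: mult.assoc zero_power flip: ennreal_mult')
  qed
  finally show ?thesis .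
qed

lemma nn_integral_pser_L0_greater:
  assumes "a 0 = 0" "0 \<le> t" "t \<le> 1"
  shows "(\<integral>\<^sup>+s. (if t < s then pser a s * omega L0 s else 0) \<partial>lborel) =
    suminf (\<lambda>n. a n * ennreal ((1 - t ^ n) / real n))"
proof -
  have "(if t < s then pser a s * omega L0 s else 0) =
      suminf (\<lambda>n. a n * (if t < s \<and> s < 1 then ennreal (s ^ (n - 1)) else 0))" for s
  proof (cases "t < s \<and> s < 1")
    case True
    then have s: "0 < s" using assms by simp
    have "a n * ennreal (s ^ n) * ennreal (1 / s) = a n * ennreal (s ^ (n - 1))" for n
      using assms(1) s by (cases n) (simp_all add: mult.assoc flip: ennreal_mult')
    then show ?thesis
      using True s assms by (simp add: pser_def omega_def flip: ennreal_suminf_multc)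
  qed (auto simp: omega_def)
  then have "(\<integral>\<^sup>+s. (if t < s then pser a s * omega L0 s else 0) \<partial>lborel) =
      suminf (\<lambda>n. a n * (\<integral>\<^sup>+s. (if t < s \<and> s < 1 then ennreal (s ^ (n - 1)) else 0) \<partial>lborel))"
    by (simp add: nn_integral_suminf nn_integral_cmult)
  also have "\<dots> = suminf (\<lambda>n. a n * ennreal ((1 - t ^ n) / real n))"
  proof (rule suminf_cong)
    fix n
    show "a n * (\<integral>\<^sup>+s. (if t < s \<and> s < 1 then ennreal (s ^ (n - 1)) else 0) \<partial>lborel) =
        a n * ennreal ((1 - t ^ n) / real n)"
      using assms nn_integral_power[of t 1 n] by (cases "n = 0") simp_all
  qed
  finally show ?thesis .
qed

text \<open>The geometric series is indexed so that its exponents are \<open>n - 1\<close>, ready to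
  be integrated to \<open>t^n / n\<close>.\<close>

lemma geometric_tail_ennreal:
  fixes s :: real
  assumes "0 < s" "s < 1"
  shows "ennreal (s ^ m) * ennreal (1 / (1 - s)) =
    suminf (\<lambda>n. if m < n then ennreal (s ^ (n - 1)) else 0)"
proof -
  let ?f = "\<lambda>n. if m < n then s ^ (n - 1) else 0"
  have "(\<lambda>n. s ^ m * s ^ n) sums (s ^ m * (1 / (1 - s)))"
    using assms by (intro sums_mult geometric_sums) simp
  moreover have "(\<lambda>n. ?f (n + Suc m)) = (\<lambda>n. s ^ m * s ^ n)"
    by (auto simp: fun_eq_iff power_add)
  ultimately have "?f sums (s ^ m * (1 / (1 - s)))"
    by (subst sums_zero_iff_shift[of "Suc m", symmetric]) auto
  then have "suminf (\<lambda>n. ennreal (?f n)) = ennreal (s ^ m * (1 / (1 - s)))"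
    using assms by (intro suminf_ennreal_eq) auto
  moreover have "ennreal (?f n) = (if m < n then ennreal (s ^ (n - 1)) else 0)" for n by simp
  moreover have "ennreal (s ^ m) * ennreal (1 / (1 - s)) = ennreal (s ^ m * (1 / (1 - s)))"
    using assms by (intro ennreal_mult[symmetric]) auto
  ultimately show ?thesis by simp
qed

text \<open>Multiplying by \<open>1 / (1 - s)\<close> replaces coefficients by partial sums;
  integration then shifts the exponent by one, so the partial sum for \<open>n\<close> stops before
  \<open>n\<close>. This strictness is that of the multiple zeta series.\<close>

lemma nn_integral_pser_L1:
  assumes "0 \<le> t" "t \<le> 1"
  shows "(\<integral>\<^sup>+s. (if s < t then pser a s * omega L1 s else 0) \<partial>lborel) =
    pser (\<lambda>n. (\<Sum>m<n. a m) * ennreal (1 / real n)) t"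
proof -
  have "(if s < t then pser a s * omega L1 s else 0) =
      suminf (\<lambda>n. (\<Sum>m<n. a m) * (if 0 < s \<and> s < t then ennreal (s ^ (n - 1)) else 0))" for s
  proof (cases "0 < s \<and> s < t")
    case True
    have "pser a s * omega L1 s = suminf (\<lambda>m. a m * (ennreal (s ^ m) * ennreal (1 / (1 - s))))"
      using True assms by (simp add: pser_def omega_def mult.assoc flip: ennreal_suminf_multc)
    also have "\<dots> = suminf (\<lambda>m. suminf (\<lambda>n. (if m < n then a m else 0) * ennreal (s ^ (n - 1))))"
      using True assms
      by (intro suminf_cong) (auto simp: geometric_tail_ennreal simp flip: ennreal_suminf_cmult
          intro!: suminf_cong)
    also have "\<dots> = suminf (\<lambda>n. suminf (\<lambda>m. (if m < n then a m else 0) * ennreal (s ^ (n - 1))))"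
      by (rule suminf_swap_ennreal)
    also have "\<dots> = suminf (\<lambda>n. (\<Sum>m<n. a m) * ennreal (s ^ (n - 1)))"
      by (simp add: suminf_if_less_ennreal)
    finally show ?thesis using True by simp
  qed (auto simp: omega_def)
  then have "(\<integral>\<^sup>+s. (if s < t then pser a s * omega L1 s else 0) \<partial>lborel) =
      suminf (\<lambda>n. (\<Sum>m<n. a m) *
        (\<integral>\<^sup>+s. (if 0 < s \<and> s < t then ennreal (s ^ (n - 1)) else 0) \<partial>lborel))"
    by (simp add: nn_integral_suminf nn_integral_cmult)
  also have "\<dots> = pser (\<lambda>n. (\<Sum>m<n. a m) * ennreal (1 / real n)) t"
    unfolding pser_def
  proof (rule suminf_cong)
    fix n
    show "(\<Sum>m<n. a m) * (\<integral>\<^sup>+s. (if 0 < s \<and> s < t then ennreal (s ^ (n - 1)) else 0) \<partial>lborel) =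
        (\<Sum>m<n. a m) * ennreal (1 / real n) * ennreal (t ^ n)"
      using assms nn_integral_power[of 0 t n]
      by (cases "n = 0") (simp_all add: mult.assoc zero_power flip: ennreal_mult')
  qed
  finally show ?thesis .
qed

text \<open>
  This is where the star sums come from: \<open>(1 - t\<^sup>n) / (1 - t) = 1 + t + \<dots> + t\<^sup>n\<^sup>-\<^sup>1\<close>.
\<close>

lemma nn_integral_pser_L0_greater_L1:
  assumes "a 0 = 0"
  shows "(\<integral>\<^sup>+s. (if t < s then pser a s * omega L0 s else 0) \<partial>lborel) * omega L1 t =
    pser (\<lambda>q. if q = 0 then 0 else suminf (\<lambda>n. if q \<le> n then a n * ennreal (1 / real n) else 0)) t *
    omega L0 t"
proof (cases "0 < t \<and> t < 1")
  case True
  let ?E = "\<lambda>q. suminf (\<lambda>n. if q \<le> n then a n * ennreal (1 / real n) else 0)"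
  have n: "ennreal ((1 - t ^ n) / real n) * ennreal (1 / (1 - t)) =
      suminf (\<lambda>q. if q \<noteq> 0 \<and> q \<le> n then ennreal (1 / real n) * ennreal (t ^ (q - 1)) else 0)" for n
  proof -
    have "suminf (\<lambda>q. if q \<noteq> 0 \<and> q \<le> n then ennreal (1 / real n) * ennreal (t ^ (q - 1)) else 0) =
        (\<Sum>q\<in>{1..n}. ennreal (1 / real n) * ennreal (t ^ (q - 1)))"
      by (subst suminf_finite[of "{1..n}"]) auto
    also have "\<dots> = ennreal (1 / real n * (\<Sum>q\<in>{1..n}. t ^ (q - 1)))"
      using True by (simp add: sum_ennreal ennreal_mult' sum_distrib_left flip: ennreal_mult')
    also have "(\<Sum>q\<in>{1..n}. t ^ (q - 1)) = (\<Sum>q<n. t ^ q)"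
      by (rule sum.reindex_bij_witness[of _ Suc "\<lambda>q. q - 1"]) auto
    also have "\<dots> = (1 - t ^ n) / (1 - t)"
      using True sum_gp_strict[of t n] by simp
    finally have "suminf (\<lambda>q. if q \<noteq> 0 \<and> q \<le> n
        then ennreal (1 / real n) * ennreal (t ^ (q - 1)) else 0) =
        ennreal (1 / real n * ((1 - t ^ n) / (1 - t)))" .
    moreover have "ennreal ((1 - t ^ n) / real n) * ennreal (1 / (1 - t)) =
        ennreal ((1 - t ^ n) / real n * (1 / (1 - t)))"
      using True power_le_one[of t n] by (intro ennreal_mult[symmetric]) auto
    ultimately show ?thesis by simp
  qed
  have "(\<integral>\<^sup>+s. (if t < s then pser a s * omega L0 s else 0) \<partial>lborel) * omega L1 t =
      suminf (\<lambda>n. a n * (ennreal ((1 - t ^ n) / real n) * ennreal (1 / (1 - t))))"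
    using True assms
    by (simp add: nn_integral_pser_L0_greater omega_def mult.assoc flip: ennreal_suminf_multc)
  also have "\<dots> = suminf (\<lambda>n. suminf (\<lambda>q.
      (if q = 0 then 0 else if q \<le> n then a n * ennreal (1 / real n) else 0) * ennreal (t ^ (q - 1))))"
    unfolding n ennreal_suminf_cmult[symmetric]
    by (intro suminf_cong) (auto simp: mult.assoc)
  also have "\<dots> = suminf (\<lambda>q. suminf (\<lambda>n.
      (if q = 0 then 0 else if q \<le> n then a n * ennreal (1 / real n) else 0) * ennreal (t ^ (q - 1))))"
    by (rule suminf_swap_ennreal)
  \<comment> \<open>Reading \<open>t^(q-1)\<close> as \<open>t^q / t\<close> exchanges the form at
    \<open>L1\<close> for the one at \<open>L0\<close>.\<close>
  also have "\<dots> = suminf (\<lambda>q. (if q = 0 then 0 else ?E q) * ennreal (t ^ q) * ennreal (1 / t))"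
  proof (rule suminf_cong)
    fix q :: nat
    show "suminf (\<lambda>n. (if q = 0 then 0 else if q \<le> n then a n * ennreal (1 / real n) else 0) *
          ennreal (t ^ (q - 1))) = (if q = 0 then 0 else ?E q) * ennreal (t ^ q) * ennreal (1 / t)"
      using True by (cases q) (simp_all add: mult.assoc flip: ennreal_mult')
  qed
  also have "\<dots> = pser (\<lambda>q. if q = 0 then 0 else ?E q) t * omega L0 t"
    using True by (simp add: pser_def omega_def)
  finally show ?thesis .
next
  case False
  then have "omega L0 t = 0" "omega L1 t = 0" by (auto simp: omega_def)
  then show ?thesis by simp
qed


section \<open>Integrals along zigzag paths\<close>

text \<open>
  The density, at the variable attached to the head of the path, of the integral over the zigzag
  with all other variables integrated out.
\<close>

fun dens :: "(bool \<times> letter) list \<Rightarrow> real \<Rightarrow> ennreal"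
  where
    "dens [] t = 0"
  | "dens [(d, x)] t = omega x t"
  | "dens ((d, y) # (e, x) # p) t =
      (\<integral>\<^sup>+s. (if (if d then s < t else t < s) then dens ((e, x) # p) s else 0) \<partial>lborel) * omega y t"

section \<open>Densities as sums over linear extensions\<close>

lemma finite_zippers: "finite (zippers p)"
  by (induction p rule: zippers.induct) (auto intro!: finite_imageI finite_SigmaI)

lemma zippers_not_mem:
  assumes "distinct (map snd ((d, x) # p))" "(u, v) \<in> zippers ((d, x) # p)"
  shows "x \<notin> set u" "x \<notin> set v"
  using assms(2) unfolding zippers_iff[OF assms(1)] by (auto simp: extends_def)

text \<open>The image in the definition of \<open>zippers\<close> is injective: the old focus
  \<open>x\<close> occurs nowhere else, so the stretch before it, and with it \<open>i\<close>, can
  be recovered.\<close>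

lemma sum_zippers_up:
  fixes f :: "'a list \<Rightarrow> 'a list \<Rightarrow> 'b::comm_monoid_add"
  assumes "distinct (map snd ((e, x) # p))"
  shows "(\<Sum>(u, v)\<in>zippers ((True, y) # (e, x) # p). f u v) =
    (\<Sum>(u, v)\<in>zippers ((e, x) # p). \<Sum>i\<le>length v. f (rev (take i v) @ x # u) (drop i v))"
proof -
  let ?Z = "zippers ((e, x) # p)"
  let ?h = "\<lambda>((u, v), i). (rev (take i v) @ x # u, drop i v)"
  have "inj_on ?h (SIGMA (u, v):?Z. {..length v})"
  proof (rule inj_onI)
    fix z z'
    assume z: "z \<in> (SIGMA (u, v):?Z. {..length v})" "z' \<in> (SIGMA (u, v):?Z. {..length v})" "?h z = ?h z'"
    obtain u v i u' v' i' where zz: "z = ((u, v), i)" "z' = ((u', v'), i')" by (metis surj_pair)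
    from z have uv: "(u, v) \<in> ?Z" "(u', v') \<in> ?Z" and i: "i \<le> length v" "i' \<le> length v'"
      and eq: "rev (take i v) @ x # u = rev (take i' v') @ x # u'" "drop i v = drop i' v'"
      by (auto simp: zz)
    have "x \<notin> set (rev (take i v))" "x \<notin> set u" "x \<notin> set (rev (take i' v'))" "x \<notin> set u'"
      using zippers_not_mem[OF assms uv(1)] zippers_not_mem[OF assms uv(2)]
      by (auto dest: in_set_takeD)
    then have t: "rev (take i v) = rev (take i' v')" "u = u'"
      using eq(1) by (simp_all add: append_Cons_eq_iff)
    then have "take i v = take i' v'" by simp
    moreover from this have "i = i'" using i by (metis length_take min.absorb2)
    moreover have "v = v'" using calculation(1) eq(2) by (metis append_take_drop_id)
    ultimately show "z = z'" using t by (simp add: zz)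
  qed
  then have "(\<Sum>(u, v)\<in>zippers ((True, y) # (e, x) # p). f u v) =
      (\<Sum>(z, i)\<in>(SIGMA (u, v):?Z. {..length v}). case ?h (z, i) of (u, v) \<Rightarrow> f u v)"
    by (simp add: sum.reindex split_def)
  also have "\<dots> = (\<Sum>z\<in>?Z. \<Sum>i\<le>length (snd z). case ?h (z, i) of (u, v) \<Rightarrow> f u v)"
    by (subst sum.Sigma) (auto simp: finite_zippers split_def)
  finally show ?thesis by (simp add: split_def)
qed

lemma sum_zippers_down:
  fixes f :: "'a list \<Rightarrow> 'a list \<Rightarrow> 'b::comm_monoid_add"
  assumes "distinct (map snd ((e, x) # p))"
  shows "(\<Sum>(u, v)\<in>zippers ((False, y) # (e, x) # p). f u v) =
    (\<Sum>(u, v)\<in>zippers ((e, x) # p). \<Sum>i\<le>length u. f (drop i u) (rev (take i u) @ x # v))"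
proof -
  let ?Z = "zippers ((e, x) # p)"
  let ?h = "\<lambda>((u, v), i). (drop i u, rev (take i u) @ x # v)"
  have "inj_on ?h (SIGMA (u, v):?Z. {..length u})"
  proof (rule inj_onI)
    fix z z'
    assume z: "z \<in> (SIGMA (u, v):?Z. {..length u})" "z' \<in> (SIGMA (u, v):?Z. {..length u})" "?h z = ?h z'"
    obtain u v i u' v' i' where zz: "z = ((u, v), i)" "z' = ((u', v'), i')" by (metis surj_pair)
    from z have uv: "(u, v) \<in> ?Z" "(u', v') \<in> ?Z" and i: "i \<le> length u" "i' \<le> length u'"
      and eq: "drop i u = drop i' u'" "rev (take i u) @ x # v = rev (take i' u') @ x # v'"
      by (auto simp: zz)
    have "x \<notin> set (rev (take i u))" "x \<notin> set v" "x \<notin> set (rev (take i' u'))" "x \<notin> set v'"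
      using zippers_not_mem[OF assms uv(1)] zippers_not_mem[OF assms uv(2)]
      by (auto dest: in_set_takeD)
    then have t: "rev (take i u) = rev (take i' u')" "v = v'"
      using eq(2) by (simp_all add: append_Cons_eq_iff)
    then have "take i u = take i' u'" by simp
    moreover from this have "i = i'" using i by (metis length_take min.absorb2)
    moreover have "u = u'" using calculation(1) eq(1) by (metis append_take_drop_id)
    ultimately show "z = z'" using t by (simp add: zz)
  qed
  then have "(\<Sum>(u, v)\<in>zippers ((False, y) # (e, x) # p). f u v) =
      (\<Sum>(z, i)\<in>(SIGMA (u, v):?Z. {..length u}). case ?h (z, i) of (u, v) \<Rightarrow> f u v)"
    by (simp add: sum.reindex split_def)
  also have "\<dots> = (\<Sum>z\<in>?Z. \<Sum>i\<le>length (fst z). case ?h (z, i) of (u, v) \<Rightarrow> f u v)"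
    by (subst sum.Sigma) (auto simp: finite_zippers split_def)
  finally show ?thesis by (simp add: split_def)
qed

text \<open>Integrating out the old focus by \<open>nn_integral_iter_int_split\<close> produces one
  term for each place of the new node, which is how \<open>zippers\<close> grows.\<close>

lemma dens_eq_sum_zippers:
  assumes "distinct (map snd ((d, x) # p))"
  shows "dens (map (apsnd \<delta>) ((d, x) # p)) t = (\<Sum>(u, v)\<in>zippers ((d, x) # p).
    iter_int (<) (map \<delta> u) t * omega (\<delta> x) t * iter_int (>) (map \<delta> v) t)"
  using assms
proof (induction p arbitrary: d x t)
  case (Cons q p)
  obtain e z where q: "q = (e, z)" by (cases q)
  let ?Z = "zippers ((e, z) # p)"
  have dist: "distinct (map snd ((e, z) # p))" using Cons.prems q by simp
  define g where "g u v s = iter_int (<) (map \<delta> u) s * omega (\<delta> z) s * iter_int (>) (map \<delta> v) s" for u v s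
  have [measurable]: "g u v \<in> borel_measurable borel" for u v
    unfolding g_def by measurable
  define P where "P s \<longleftrightarrow> (if d then s < t else t < s)" for s
  have [measurable]: "Measurable.pred borel P"
    unfolding P_def by (cases d) simp_all
  have "dens (map (apsnd \<delta>) ((d, x) # q # p)) t =
      (\<integral>\<^sup>+s. (if P s then \<Sum>(u, v)\<in>?Z. g u v s else 0) \<partial>lborel) * omega (\<delta> x) t"
    using Cons.IH[OF dist] by (simp add: q P_def g_def cong: if_cong)
  also have "(\<integral>\<^sup>+s. (if P s then \<Sum>(u, v)\<in>?Z. g u v s else 0) \<partial>lborel) =
      (\<integral>\<^sup>+s. (\<Sum>z\<in>?Z. if P s then g (fst z) (snd z) s else 0) \<partial>lborel)"
    by (intro nn_integral_cong) (simp add: split_def)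
  also have "\<dots> = (\<Sum>(u, v)\<in>?Z. \<integral>\<^sup>+s. (if P s then g u v s else 0) \<partial>lborel)"
    by (subst nn_integral_sum) (auto simp: split_def)
  finally have *: "dens (map (apsnd \<delta>) ((d, x) # q # p)) t =
      (\<Sum>(u, v)\<in>?Z. \<integral>\<^sup>+s. (if P s then g u v s else 0) \<partial>lborel) * omega (\<delta> x) t" .
  show ?case
  proof (cases d)
    case True
    have "(\<integral>\<^sup>+s. (if P s then g u v s else 0) \<partial>lborel) = (\<Sum>i\<le>length v.
        iter_int (<) (map \<delta> (rev (take i v) @ z # u)) t * iter_int (>) (map \<delta> (drop i v)) t)" for u v
      using nn_integral_iter_int_split[of "(<)" "(>)" t "map \<delta> u" "\<delta> z" "map \<delta> v"] True
      by (simp add: P_def g_def take_map drop_map rev_map cong: if_cong)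
    moreover have d: "d = True" using True by simp
    ultimately show ?thesis
      unfolding * unfolding q d sum_zippers_up[OF dist]
      by (simp only: sum_distrib_left sum_distrib_right split_def mult_ac)
  next
    case False
    \<comment> \<open>Going down, \<open>t\<close> lies among the variables below the old focus, so
      the two chains exchange their roles.\<close>
    have "(\<integral>\<^sup>+s. (if P s then g u v s else 0) \<partial>lborel) = (\<Sum>i\<le>length u.
        iter_int (<) (map \<delta> (drop i u)) t * iter_int (>) (map \<delta> (rev (take i u) @ z # v)) t)" for u v
      using nn_integral_iter_int_split[of "(>)" "(<)" t "map \<delta> v" "\<delta> z" "map \<delta> u"] False
      by (simp add: P_def g_def take_map drop_map rev_map mult_ac cong: if_cong)
    moreover have d: "d = False" using False by simp
    ultimately show ?thesis
      unfolding * unfolding q d sum_zippers_down[OF dist]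
      by (simp only: sum_distrib_left sum_distrib_right split_def mult_ac)
  qed
qed simp

text \<open>Integrating the last free variable closes each zipper to a full linear extension; the
  word is reversed because \<open>iter_int\<close> starts at the largest variable.\<close>

lemma nn_integral_dens:
  assumes "distinct (map snd ((d, x) # p))"
  shows "(\<integral>\<^sup>+t. dens (map (apsnd \<delta>) ((d, x) # p)) t \<partial>lborel) =
    (\<Sum>xs | extends (snd ` set ((d, x) # p)) (path_rel ((d, x) # p)) xs.
      iter_int (<) (rev (map \<delta> xs)) 1)"
proof -
  have "(\<integral>\<^sup>+t. dens (map (apsnd \<delta>) ((d, x) # p)) t \<partial>lborel) =
      (\<integral>\<^sup>+t. (\<Sum>z\<in>zippers ((d, x) # p). iter_int (<) (map \<delta> (fst z)) t * omega (\<delta> x) t *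
        iter_int (>) (map \<delta> (snd z)) t) \<partial>lborel)"
    unfolding dens_eq_sum_zippers[OF assms] split_def ..
  also have "\<dots> = (\<Sum>(u, v)\<in>zippers ((d, x) # p). iter_int (<) (rev (map \<delta> (rev u @ x # v))) 1)"
    by (subst nn_integral_sum) (auto simp: nn_integral_iter_int_focus rev_map split_def)
  also have "\<dots> = (\<Sum>xs | extends (snd ` set ((d, x) # p)) (path_rel ((d, x) # p)) xs.
      iter_int (<) (rev (map \<delta> xs)) 1)"
    using sum.reindex_bij_betw[OF bij_betw_zippers[OF assms],
        of "\<lambda>xs. iter_int (<) (rev (map \<delta> xs)) 1"]
    by (simp add: split_def)
  finally show ?thesis .
qed


subsection \<open>Evaluation by power series\<close>

text \<open>One factor \<open>e_k\<close> with \<open>k = Suc j\<close>, read backwards: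
  \<open>L1\<close> forms partial sums and divides by \<open>n\<close>, and each \<open>L0\<close>
  divides by \<open>n\<close> once more.\<close>

lemma iter_int_replicate:
  assumes a: "\<And>t. 0 \<le> t \<Longrightarrow> t \<le> 1 \<Longrightarrow> iter_int (<) w t = pser a t"
    and t: "0 \<le> t" "t \<le> 1"
  shows "iter_int (<) (replicate j L0 @ L1 # w) t =
    pser (\<lambda>n. (\<Sum>m<n. a m) * ennreal (1 / real n) ^ Suc j) t"
  using t
proof (induction j arbitrary: t)
  case 0
  have "iter_int (<) (L1 # w) t = (\<integral>\<^sup>+s. (if s < t then pser a s * omega L1 s else 0) \<partial>lborel)"
    unfolding iter_int.simps
    by (intro nn_integral_cong) (use a 0 in \<open>auto simp: omega_def\<close>)
  then show ?case
    using nn_integral_pser_L1[OF 0] by simp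
next
  case (Suc j)
  let ?b = "\<lambda>n. (\<Sum>m<n. a m) * ennreal (1 / real n) ^ Suc j"
  have "iter_int (<) (L0 # replicate j L0 @ L1 # w) t =
      (\<integral>\<^sup>+s. (if s < t then pser ?b s * omega L0 s else 0) \<partial>lborel)"
    unfolding iter_int.simps
    by (intro nn_integral_cong) (use Suc in \<open>auto simp: omega_def simp del: power_Suc\<close>)
  also have "\<dots> = pser (\<lambda>n. ?b n * ennreal (1 / real n)) t"
    using Suc.prems by (intro nn_integral_pser_L0) simp_all
  finally show ?case by (simp add: mult_ac)
qed

text \<open>The power series of the multiple polylogarithm of \<open>ks\<close>: the exponent of
  \<open>t\<close> is the largest summation variable.\<close>

lemma iter_int_index_word:
  assumes "is_index ks" "0 \<le> t" "t \<le> 1"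
  shows "iter_int (<) (rev (letters (index_word ks))) t = pser (\<lambda>n. ennreal (last_sum 0 n ks)) t"
  using assms
proof (induction ks arbitrary: t rule: rev_induct)
  case Nil
  have "pser (\<lambda>n. ennreal (last_sum 0 n [])) t = (\<Sum>n\<in>{0}. ennreal (last_sum 0 n []) * ennreal (t ^ n))"
    unfolding pser_def by (rule suminf_finite) auto
  then show ?case by (simp add: index_word_def)
next
  case (snoc k ks)
  have k: "Suc (k - 1) = k" using snoc.prems by simp
  have "rev (letters (index_word (ks @ [k]))) =
      replicate (k - 1) L0 @ L1 # rev (letters (index_word ks))"
    by (simp add: index_word_def)
  moreover have "(\<Sum>m<n. ennreal (last_sum 0 m ks)) * ennreal (1 / real n) ^ k =
      ennreal (last_sum 0 n (ks @ [k]))" for n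
    by (simp add: last_sum_0_snoc last_sum_nonneg sum_nonneg ennreal_power power_divide
        flip: ennreal_mult')
  ultimately show ?case
    using snoc iter_int_replicate[of "rev (letters (index_word ks))" _ t "k - 1"] by (simp add: k)
qed

text \<open>The labels and directions of the \<open>b\<close>-part. The bottom of the last block is
  reached from \<open>a_K\<close> by going up and carries \<open>L0\<close>; every other bottom is
  reached by going down from the top of the next block and carries \<open>L1\<close>.\<close>

fun blocks :: "nat list \<Rightarrow> (bool \<times> letter) list"
  where
    "blocks [] = []"
  | "blocks (l # ls) = replicate (l - 1) (True, L0) @
      (if ls = [] then (True, L0) else (False, L1)) # blocks ls"

text \<open>The coefficient of \<open>t^p\<close> once the blocks of \<open>ls\<close> have been
  integrated out: a series over the common largest variable \<open>n\<close>, with the star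
  variables bounded below by \<open>p\<close>. The value 0 at \<open>p = 0\<close> keeps
  \<open>dt / t\<close> integrable.\<close>

definition tail_coeff :: "nat list \<Rightarrow> nat list \<Rightarrow> nat \<Rightarrow> ennreal"
  where "tail_coeff ks ls p =
    (if p = 0 then 0 else suminf (\<lambda>n. ennreal (last_sum 0 n ks * star_sum p n ls)))"

lemma tail_coeff_Nil: "ks \<noteq> [] \<Longrightarrow> tail_coeff ks [] p = ennreal (last_sum 0 p ks)"
proof -
  assume "ks \<noteq> []"
  moreover have "suminf (\<lambda>n. ennreal (last_sum 0 n ks * star_sum p n [])) =
      (\<Sum>n\<in>{p}. ennreal (last_sum 0 n ks * star_sum p n []))"
    by (rule suminf_finite) auto
  ultimately show ?thesis by (simp add: tail_coeff_def last_sum_diag)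
qed

text \<open>Exchanging the smallest star variable \<open>q\<close> with \<open>n\<close> exhibits
  the effect of one block: \<open>l\<close> divisions by \<open>q\<close>, then the sum over
  \<open>q >= p\<close> caused by the step down.\<close>

lemma tail_coeff_Cons:
  "tail_coeff ks (l # ls) p = (if p = 0 then 0 else
    suminf (\<lambda>q. if p \<le> q then tail_coeff ks ls q * ennreal (1 / real q) ^ l else 0))"
proof (cases "p = 0")
  case False
  have "ennreal (last_sum 0 n ks * star_sum p n (l # ls)) =
      suminf (\<lambda>q. if p \<le> q \<and> q \<le> n
        then ennreal (last_sum 0 n ks * star_sum q n ls) * ennreal (1 / real q) ^ l else 0)" for n
  proof -
    have "suminf (\<lambda>q. if p \<le> q \<and> q \<le> n
        then ennreal (last_sum 0 n ks * star_sum q n ls) * ennreal (1 / real q) ^ l else 0) =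
        (\<Sum>q\<in>{p..n}. ennreal (last_sum 0 n ks * star_sum q n ls) * ennreal (1 / real q) ^ l)"
      by (subst suminf_finite[of "{p..n}"]) auto
    also have "\<dots> = (\<Sum>q\<in>{p..n}. ennreal (last_sum 0 n ks * (1 / real q ^ l * star_sum q n ls)))"
      by (intro sum.cong refl)
        (simp add: ennreal_power power_divide last_sum_nonneg star_sum_nonneg flip: ennreal_mult')
    also have "\<dots> = ennreal (last_sum 0 n ks * star_sum p n (l # ls))"
      by (subst sum_ennreal) (simp_all add: last_sum_nonneg star_sum_nonneg sum_distrib_left)
    finally show ?thesis by (rule sym)
  qed
  then have "tail_coeff ks (l # ls) p = suminf (\<lambda>n. suminf (\<lambda>q. if p \<le> q \<and> q \<le> n
        then ennreal (last_sum 0 n ks * star_sum q n ls) * ennreal (1 / real q) ^ l else 0))"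
    using False by (simp add: tail_coeff_def del: star_sum.simps)
  also have "\<dots> = suminf (\<lambda>q. suminf (\<lambda>n. if p \<le> q \<and> q \<le> n
        then ennreal (last_sum 0 n ks * star_sum q n ls) * ennreal (1 / real q) ^ l else 0))"
    by (rule suminf_swap_ennreal)
  also have "\<dots> = suminf (\<lambda>q. if p \<le> q then tail_coeff ks ls q * ennreal (1 / real q) ^ l else 0)"
  proof (rule suminf_cong)
    fix q
    \<comment> \<open>The condition \<open>q <= n\<close> can therefore be dropped, and the inner
      series becomes \<open>tail_coeff ks ls q\<close>.\<close>
    have "star_sum q n ls = 0" if "\<not> q \<le> n" for n
      using that by (cases ls) auto
    then have "(if p \<le> q \<and> q \<le> n
        then ennreal (last_sum 0 n ks * star_sum q n ls) * ennreal (1 / real q) ^ l else 0) =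
        (if p \<le> q then ennreal (last_sum 0 n ks * star_sum q n ls) * ennreal (1 / real q) ^ l else 0)"
      for n by auto
    then show "suminf (\<lambda>n. if p \<le> q \<and> q \<le> n
        then ennreal (last_sum 0 n ks * star_sum q n ls) * ennreal (1 / real q) ^ l else 0) =
        (if p \<le> q then tail_coeff ks ls q * ennreal (1 / real q) ^ l else 0)"
      using False by (simp add: tail_coeff_def)
  qed
  finally show ?thesis using False by simp
qed (simp add: tail_coeff_def)

text \<open>The invariant of the \<open>b\<close>-part, a power series without constant term times
  the form at \<open>L0\<close>, is preserved by steps up to \<open>L0\<close>;
  \<open>dens_down_L1\<close> does the same for steps down to \<open>L1\<close>.\<close>

lemma dens_up_L0:
  assumes "\<And>t. dens p t = pser a t * omega L0 t" "p \<noteq> []" "a 0 = 0"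
  shows "dens ((True, L0) # p) t = pser (\<lambda>n. a n * ennreal (1 / real n)) t * omega L0 t"
proof -
  obtain e x p' where p: "p = (e, x) # p'" using assms(2) by (cases p) auto
  have "dens ((True, L0) # p) t =
      (\<integral>\<^sup>+s. (if s < t then pser a s * omega L0 s else 0) \<partial>lborel) * omega L0 t"
    using assms(1) by (simp add: p cong: if_cong)
  then show ?thesis
    using nn_integral_pser_L0[of a t] assms(3) by (cases "0 < t \<and> t < 1") (auto simp: omega_def)
qed

lemma dens_replicate_L0:
  assumes "\<And>t. dens p t = pser a t * omega L0 t" "p \<noteq> []" "a 0 = 0"
  shows "dens (replicate j (True, L0) @ p) t =
    pser (\<lambda>n. a n * ennreal (1 / real n) ^ j) t * omega L0 t"
proof (induction j arbitrary: t)
  case (Suc j)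
  show ?case
    using dens_up_L0[of "replicate j (True, L0) @ p", OF Suc] assms(2,3) by (simp add: mult_ac)
qed (use assms(1) in simp)

lemma dens_down_L1:
  assumes "\<And>t. dens p t = pser a t * omega L0 t" "p \<noteq> []" "a 0 = 0"
  shows "dens ((False, L1) # p) t =
    pser (\<lambda>q. if q = 0 then 0 else suminf (\<lambda>n. if q \<le> n then a n * ennreal (1 / real n) else 0)) t *
    omega L0 t"
proof -
  obtain e x p' where p: "p = (e, x) # p'" using assms(2) by (cases p) auto
  show ?thesis
    using assms(1) nn_integral_pser_L0_greater_L1[of a t] assms(3) by (simp add: p cong: if_cong)
qed

text \<open>Without turns the nested integrals are those of an ordinary word; this handles the
  \<open>a\<close>-part.\<close>

lemma dens_chain:
  "w \<noteq> [] \<Longrightarrow> dens ((True, y) # map (Pair True) w) t = iter_int (<) w t * omega y t"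
proof (induction w arbitrary: y t)
  case (Cons x w)
  then show ?case by (cases w) (auto cong: if_cong)
qed simp

text \<open>The exponent is \<open>l - 1\<close> because the last division by \<open>n\<close>
  belongs to the step that leaves the block, be it a step down or the final integration.\<close>

lemma dens_blocks:
  assumes "is_index ks" "ks \<noteq> []" "is_index (l # ls)"
  shows "dens (blocks (l # ls) @ map (Pair True) (rev (letters (index_word ks)))) t =
    pser (\<lambda>n. tail_coeff ks ls n * ennreal (1 / real n) ^ (l - 1)) t * omega L0 t"
  using assms(3)
proof (induction ls arbitrary: l t)
  case Nil
  let ?w = "rev (letters (index_word ks))"
  have "?w \<noteq> []" using assms(2) by (cases ks) (auto simp: index_word_def)
  then have "dens ((True, L0) # map (Pair True) ?w) t =
      pser (\<lambda>n. ennreal (last_sum 0 n ks)) t * omega L0 t" for t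
    using iter_int_index_word[OF assms(1), of t] by (simp add: dens_chain omega_def)
  then have "dens (replicate (l - 1) (True, L0) @ (True, L0) # map (Pair True) ?w) t =
      pser (\<lambda>n. ennreal (last_sum 0 n ks) * ennreal (1 / real n) ^ (l - 1)) t * omega L0 t"
    by (rule dens_replicate_L0) (simp_all add: last_sum_diag assms(2))
  then show ?case
    using assms(2) by (simp add: tail_coeff_Nil)
next
  case (Cons l' ls)
  let ?p = "blocks (l' # ls) @ map (Pair True) (rev (letters (index_word ks)))"
  let ?a = "\<lambda>n. tail_coeff ks ls n * ennreal (1 / real n) ^ (l' - 1)"
  \<comment> \<open>The step down supplies the missing division; \<open>l' >= 1\<close> makes the
    truncated subtraction exact.\<close>
  have pow: "c * x ^ (l' - 1) * x = c * x ^ l'" for c x :: ennreal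
    using Cons.prems by (cases l') (simp_all add: mult_ac)
  have "dens ?p t = pser ?a t * omega L0 t" for t
    using Cons.prems by (intro Cons.IH) simp
  then have "dens ((False, L1) # ?p) t =
      pser (\<lambda>q. if q = 0 then 0 else suminf (\<lambda>n. if q \<le> n then ?a n * ennreal (1 / real n) else 0)) t *
      omega L0 t" for t
    by (rule dens_down_L1) (simp_all add: tail_coeff_def)
  also have "(\<lambda>q. if q = 0 then 0 else
      suminf (\<lambda>n. if q \<le> n then ?a n * ennreal (1 / real n) else 0)) = tail_coeff ks (l' # ls)"
    by (rule ext) (simp only: tail_coeff_Cons pow)
  finally have "dens (replicate (l - 1) (True, L0) @ (False, L1) # ?p) t =
      pser (\<lambda>n. tail_coeff ks (l' # ls) n * ennreal (1 / real n) ^ (l - 1)) t * omega L0 t"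
    by (rule dens_replicate_L0) (simp_all add: tail_coeff_def)
  then show ?case by simp
qed

lemma nn_integral_dens_blocks:
  assumes "is_index ks" "ks \<noteq> []" "is_index ls" "ls \<noteq> []"
  shows "(\<integral>\<^sup>+t. dens (blocks ls @ map (Pair True) (rev (letters (index_word ks)))) t \<partial>lborel) =
    suminf (\<lambda>n. ennreal (last_sum 0 n ks * star_sum 1 n ls))"
proof -
  obtain l ls' where ls: "ls = l # ls'" using assms(4) by (cases ls) auto
  have pow: "c * x ^ (l - 1) * x = c * x ^ l" for c x :: ennreal
    using assms(3) by (cases l) (simp_all add: ls mult_ac)
  let ?a = "\<lambda>n. tail_coeff ks ls' n * ennreal (1 / real n) ^ (l - 1)"
  have "dens (blocks ls @ map (Pair True) (rev (letters (index_word ks)))) t =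
      pser ?a t * omega L0 t" for t
    unfolding ls using assms by (intro dens_blocks) (simp_all add: ls)
  then have "(\<integral>\<^sup>+t. dens (blocks ls @ map (Pair True) (rev (letters (index_word ks)))) t \<partial>lborel) =
      (\<integral>\<^sup>+t. (if t < 1 then pser ?a t * omega L0 t else 0) \<partial>lborel)"
    by (simp only: nn_integral_omega_lessThan_1)
  also have "\<dots> = pser (\<lambda>n. ?a n * ennreal (1 / real n)) 1"
    by (rule nn_integral_pser_L0) (simp_all add: tail_coeff_def)
  also have "\<dots> = suminf (\<lambda>n. tail_coeff ks ls' n * ennreal (1 / real n) ^ l)"
    by (simp only: pser_def pow power_one ennreal_1 mult_1_right)
  \<comment> \<open>The plain sum over all \<open>n\<close> is the recursion at lower bound 1, since
    the term at 0 vanishes.\<close>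
  also have "\<dots> = tail_coeff ks ls 1"
    unfolding ls tail_coeff_Cons
    by (auto intro!: suminf_cong simp: tail_coeff_def)
  finally show ?thesis by (simp add: tail_coeff_def)
qed


section \<open>The zigzag of \<open>\<mu>\<close>\<close>

definition apath :: "nat \<Rightarrow> (bool \<times> node) list"
  where "apath K = map (\<lambda>t. (True, NA t)) (rev [1..<Suc K])"

definition block :: "nat \<Rightarrow> nat \<Rightarrow> bool \<Rightarrow> (bool \<times> node) list"
  where "block j l d = map (\<lambda>i. (True, NB j i)) (rev [2..<Suc l]) @ [(d, NB j 1)]"

text \<open>The flag \<open>ls = []\<close> singles out the last block, whose bottom lies above
  \<open>a_K\<close>; every other bottom lies below the top of the following block.\<close>

fun bpath :: "nat \<Rightarrow> nat list \<Rightarrow> (bool \<times> node) list"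
  where
    "bpath j [] = []"
  | "bpath j (l # ls) = block j l (ls = []) @ bpath (Suc j) ls"

lemma set_apath: "snd ` set (apath K) = {NA t | t. 1 \<le> t \<and> t \<le> K}"
  by (auto simp: apath_def image_iff)

lemma set_block: "1 \<le> l \<Longrightarrow> snd ` set (block j l d) = {NB j i | i. 1 \<le> i \<and> i \<le> l}"
  by (auto simp: block_def image_iff Suc_le_eq)

lemma set_bpath:
  "is_index ls \<Longrightarrow>
    snd ` set (bpath j ls) = {NB (j + m) i | m i. m < length ls \<and> 1 \<le> i \<and> i \<le> ls ! m}"
proof (induction ls arbitrary: j)
  case (Cons l ls)
  have "snd ` set (bpath j (l # ls)) = {NB j i | i. 1 \<le> i \<and> i \<le> l} \<union>
      {NB (Suc j + m) i | m i. m < length ls \<and> 1 \<le> i \<and> i \<le> ls ! m}"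
    using Cons by (simp add: image_Un set_block)
  also have "\<dots> = {NB (j + m) i | m i. m < length (l # ls) \<and> 1 \<le> i \<and> i \<le> (l # ls) ! m}"
    by (fastforce simp: less_Suc_eq_0_disj)
  finally show ?case .
qed simp

lemma distinct_apath: "distinct (map snd (apath K))"
  by (simp add: apath_def o_def distinct_map inj_on_def)

lemma distinct_block: "distinct (map snd (block j l d))"
  by (auto simp: block_def o_def distinct_map inj_on_def)

lemma distinct_bpath: "is_index ls \<Longrightarrow> distinct (map snd (bpath j ls))"
proof (induction ls arbitrary: j)
  case (Cons l ls)
  have "snd ` set (block j l (ls = [])) \<inter> snd ` set (bpath (Suc j) ls) = {}"
    using Cons.prems by (auto simp: set_block set_bpath)
  then show ?case using Cons by (simp add: distinct_block)
qed simp

lemma path_rel_append: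
  assumes "p \<noteq> []" "q \<noteq> []"
  shows "path_rel (p @ q) = path_rel p \<union> path_rel q \<union>
    {if fst (last p) then (snd (hd q), snd (last p)) else (snd (last p), snd (hd q))}"
  using assms
proof (induction p rule: path_rel.induct)
  case (1 d y e x p)
  then show ?case by auto
next
  case ("2_2" v)
  then show ?case by (cases v; cases q) auto
qed simp

lemma path_rel_apath: "path_rel (apath K) = {(NA t, NA (t + 1)) | t. 1 \<le> t \<and> t < K}"
proof (induction K)
  case (Suc K)
  have "path_rel (apath (Suc K)) =
      (if K = 0 then {} else insert (NA K, NA (Suc K)) (path_rel (apath K)))"
    by (cases K) (simp_all add: apath_def)
  then show ?case using Suc by (auto simp: less_Suc_eq)
qed (simp add: apath_def)

lemma hd_block: "1 \<le> l \<Longrightarrow> snd (hd (block j l d)) = NB j l"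
  by (cases "l = 1") (auto simp: block_def hd_append hd_rev)

lemma block_ne [simp]: "block j l d \<noteq> []"
  by (simp add: block_def)

lemma last_block: "last (block j l d) = (d, NB j 1)"
  by (simp add: block_def)

lemma path_rel_block:
  "1 \<le> l \<Longrightarrow> path_rel (block j l d) = {(NB j i, NB j (i + 1)) | i. 1 \<le> i \<and> i < l}"
proof (induction l rule: dec_induct)
  case base
  show ?case by (simp add: block_def)
next
  case (step l)
  have "block j (Suc l) d = [(True, NB j (Suc l))] @ block j l d"
    using step by (simp add: block_def)
  then have "path_rel (block j (Suc l) d) = insert (NB j l, NB j (Suc l)) (path_rel (block j l d))"
    using step by (simp only: path_rel_append[OF list.distinct(2) block_ne]) (simp add: hd_block)
  then show ?case using step by (auto simp: less_Suc_eq)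
qed

lemma apath_ne: "1 \<le> K \<Longrightarrow> apath K \<noteq> []"
  by (simp add: apath_def)

lemma hd_apath: "1 \<le> K \<Longrightarrow> hd (apath K) = (True, NA K)"
  by (simp add: apath_def hd_map hd_rev)

text \<open>The starting number \<open>j\<close> is arbitrary, since the induction removes the first
  block without renumbering the others. New pairs arise only at the seams between blocks, by
  \<open>path_rel_append\<close>.\<close>

lemma path_rel_zigzag:
  assumes "1 \<le> K" "is_index ls" "ls \<noteq> []"
  shows "path_rel (bpath j ls @ apath K) =
    {(NA t, NA (t + 1)) | t. 1 \<le> t \<and> t < K} \<union> {(NA K, NB (j + length ls - 1) 1)} \<union>
    {(NB (j + m) i, NB (j + m) (i + 1)) | m i. m < length ls \<and> 1 \<le> i \<and> i < ls ! m} \<union>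
    {(NB (j + m) 1, NB (j + Suc m) (ls ! Suc m)) | m. Suc m < length ls}"
  using assms(2,3)
proof (induction ls arbitrary: j)
  case (Cons l ls)
  have l: "1 \<le> l" using Cons.prems by simp
  show ?case
  proof (cases ls)
    case Nil
    have "path_rel (bpath j (l # ls) @ apath K) =
        {(NB j i, NB j (i + 1)) | i. 1 \<le> i \<and> i < l} \<union>
        {(NA t, NA (t + 1)) | t. 1 \<le> t \<and> t < K} \<union> {(NA K, NB j 1)}"
      using assms(1) l Nil
      by (simp add: path_rel_append apath_ne path_rel_block path_rel_apath last_block hd_apath)
    then show ?thesis by (auto simp: Nil)
  next
    case (Cons l' ls')
    let ?q = "bpath (Suc j) ls @ apath K"
    have ne: "?q \<noteq> []" by (simp add: Cons)
    have l': "1 \<le> l'" using Cons.prems Cons by simp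
    have hd: "snd (hd ?q) = NB (Suc j) (ls ! 0)" using l' by (simp add: Cons hd_append hd_block)
    have "path_rel (bpath j (l # ls) @ apath K) =
        {(NB j i, NB j (i + 1)) | i. 1 \<le> i \<and> i < l} \<union> path_rel ?q \<union> {(NB j 1, NB (Suc j) (ls ! 0))}"
    proof -
      have "bpath j (l # ls) @ apath K = block j l False @ ?q" by (simp add: Cons)
      then show ?thesis
        using l by (simp only: path_rel_append[OF block_ne ne] hd last_block path_rel_block) simp
    qed
    moreover have "path_rel ?q =
        {(NA t, NA (t + 1)) | t. 1 \<le> t \<and> t < K} \<union> {(NA K, NB (Suc j + length ls - 1) 1)} \<union>
        {(NB (Suc j + m) i, NB (Suc j + m) (i + 1)) | m i. m < length ls \<and> 1 \<le> i \<and> i < ls ! m} \<union>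
        {(NB (Suc j + m) 1, NB (Suc j + Suc m) (ls ! Suc m)) | m. Suc m < length ls}"
      using Cons.prems Cons by (intro Cons.IH) simp_all
    moreover have "{(NB (j + m) i, NB (j + m) (i + 1)) | m i.
          m < length (l # ls) \<and> 1 \<le> i \<and> i < (l # ls) ! m} =
        {(NB j i, NB j (i + 1)) | i. 1 \<le> i \<and> i < l} \<union>
        {(NB (Suc j + m) i, NB (Suc j + m) (i + 1)) | m i. m < length ls \<and> 1 \<le> i \<and> i < ls ! m}"
      by (fastforce simp: less_Suc_eq_0_disj)
    moreover have "{(NB (j + m) 1, NB (j + Suc m) ((l # ls) ! Suc m)) | m. Suc m < length (l # ls)} =
        {(NB j 1, NB (Suc j) (ls ! 0))} \<union>
        {(NB (Suc j + m) 1, NB (Suc j + Suc m) (ls ! Suc m)) | m. Suc m < length ls}"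
      using Cons by (fastforce simp: less_Suc_eq_0_disj)
    moreover have "j + length (l # ls) - 1 = Suc j + length ls - 1" by simp
    ultimately show ?thesis by (simp only:) blast
  qed
qed simp

lemma mu_nodes_eq:
  "is_index ls \<Longrightarrow> mu_nodes ks ls = snd ` set (bpath 1 ls @ apath (sum_list ks))"
proof -
  assume "is_index ls"
  have "{NB j i | j i. 1 \<le> j \<and> j \<le> length ls \<and> 1 \<le> i \<and> i \<le> ls ! (j - 1)} =
      {NB (1 + m) i | m i. m < length ls \<and> 1 \<le> i \<and> i \<le> ls ! m}" (is "?A = ?B")
  proof
    show "?A \<subseteq> ?B"
    proof clarify
      fix j i
      assume "1 \<le> j" "j \<le> length ls" "1 \<le> i" "i \<le> ls ! (j - 1)"
      then show "\<exists>m i'. NB j i = NB (1 + m) i' \<and> m < length ls \<and> 1 \<le> i' \<and> i' \<le> ls ! m"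
        by (intro exI[of _ "j - 1"] exI[of _ i]) auto
    qed
  qed fastforce
  with \<open>is_index ls\<close> show ?thesis
    by (auto simp: mu_nodes_def image_Un set_bpath set_apath)
qed

lemma mu_relations_eq:
  assumes "is_index ks" "ks \<noteq> []" "is_index ls" "ls \<noteq> []"
  shows "mu_relations ks ls = path_rel (bpath 1 ls @ apath (sum_list ks))"
proof -
  have K: "1 \<le> sum_list ks" using assms by (cases ks) auto
  have 1: "{(NB j i, NB j (i + 1)) | j i. 1 \<le> j \<and> j \<le> length ls \<and> 1 \<le> i \<and> i < ls ! (j - 1)} =
      {(NB (1 + m) i, NB (1 + m) (i + 1)) | m i. m < length ls \<and> 1 \<le> i \<and> i < ls ! m}"
    (is "?A = ?B")
  proof
    show "?A \<subseteq> ?B"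
    proof clarify
      fix j i
      assume "1 \<le> j" "j \<le> length ls" "1 \<le> i" "i < ls ! (j - 1)"
      then show "\<exists>m i'. (NB j i, NB j (i + 1)) = (NB (1 + m) i', NB (1 + m) (i' + 1)) \<and>
          m < length ls \<and> 1 \<le> i' \<and> i' < ls ! m"
        by (intro exI[of _ "j - 1"] exI[of _ i]) auto
    qed
  qed fastforce
  have 2: "{(NB (j - 1) 1, NB j (ls ! (j - 1))) | j. 2 \<le> j \<and> j \<le> length ls} =
      {(NB (1 + m) 1, NB (1 + Suc m) (ls ! Suc m)) | m. Suc m < length ls}" (is "?A = ?B")
  proof
    show "?A \<subseteq> ?B"
    proof clarify
      fix j
      assume "2 \<le> j" "j \<le> length ls"
      then show "\<exists>m. (NB (j - 1) 1, NB j (ls ! (j - 1))) =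
          (NB (1 + m) 1, NB (1 + Suc m) (ls ! Suc m)) \<and> Suc m < length ls"
        by (intro exI[of _ "j - 2"]) (auto simp: Suc_diff_Suc numeral_2_eq_2)
    qed
    show "?B \<subseteq> ?A"
    proof clarify
      fix m
      assume "Suc m < length ls"
      then show "\<exists>j. (NB (1 + m) 1, NB (1 + Suc m) (ls ! Suc m)) =
          (NB (j - 1) 1, NB j (ls ! (j - 1))) \<and> 2 \<le> j \<and> j \<le> length ls"
        by (intro exI[of _ "m + 2"]) auto
    qed
  qed
  show ?thesis
    unfolding path_rel_zigzag[OF K assms(3,4)] mu_relations_def 1 2 by simp
qed

section \<open>Labels along the zigzag\<close>

lemma mu_label_apath:
  "is_index ks \<Longrightarrow>
    map (\<lambda>t. mu_label ks ls (NA t)) [1..<Suc (sum_list ks)] = letters (index_word ks)"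
proof (induction ks rule: rev_induct)
  case (snoc k ks)
  let ?K = "sum_list ks"
  have k: "1 \<le> k" using snoc.prems by simp
  have take_le: "sum_list (take j ks) \<le> ?K" for j
    by (metis append_take_drop_id le_add1 sum_list_append)
  have lab: "mu_label (ks @ [k]) ls (NA t) =
      (if t = Suc ?K then L1 else mu_label ks ls (NA t))" for t
  proof -
    have "(\<exists>j<length (ks @ [k]). t = sum_list (take j (ks @ [k])) + 1) \<longleftrightarrow>
        t = Suc ?K \<or> (\<exists>j<length ks. t = sum_list (take j ks) + 1)"
      by (auto simp: less_Suc_eq)
    then show ?thesis by simp
  qed
  have beyond: "mu_label ks ls (NA t) = L0" if "Suc ?K < t" for t
    using that take_le by (auto simp: not_less[symmetric])
  have "[1..<Suc (sum_list (ks @ [k]))] = [1..<Suc ?K] @ Suc ?K # [Suc (Suc ?K)..<Suc ?K + k]"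
    using k upt_add_eq_append[of 1 "Suc ?K" k] by (simp add: upt_conv_Cons)
  moreover have "map (\<lambda>t. mu_label (ks @ [k]) ls (NA t)) [1..<Suc ?K] = letters (index_word ks)"
  proof -
    have "map (\<lambda>t. mu_label (ks @ [k]) ls (NA t)) [1..<Suc ?K] =
        map (\<lambda>t. mu_label ks ls (NA t)) [1..<Suc ?K]"
      by (intro map_cong) (auto simp: lab simp del: mu_label.simps upt_Suc)
    also have "\<dots> = letters (index_word ks)"
      using snoc.prems by (intro snoc.IH) simp
    finally show ?thesis .
  qed
  moreover have "mu_label (ks @ [k]) ls (NA (Suc ?K)) = L1" by (simp add: lab del: mu_label.simps)
  moreover have "map (\<lambda>t. mu_label (ks @ [k]) ls (NA t)) [Suc (Suc ?K)..<Suc ?K + k] =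
      map (\<lambda>t. L0) [Suc (Suc ?K)..<Suc ?K + k]"
    by (intro map_cong) (auto simp: lab beyond simp del: mu_label.simps)
  ultimately show ?case
    by (simp add: index_word_def map_replicate_const del: mu_label.simps upt_Suc)
qed (simp add: index_word_def)

text \<open>The hypothesis says that \<open>ms\<close> stands for the blocks from number
  \<open>j\<close> to the end, so that the block with \<open>j = length ls\<close> is the last entry
  of \<open>ms\<close>.\<close>

lemma mu_label_bpath:
  assumes "Suc (length ls) = j + length ms"
  shows "map (apsnd (mu_label ks ls)) (bpath j ms) = blocks ms"
  using assms
proof (induction ms arbitrary: j)
  case (Cons m ms)
  have "map (apsnd (mu_label ks ls)) (block j m (ms = [])) =
      map (\<lambda>i. (True, L0)) (rev [2..<Suc m]) @ [if ms = [] then (True, L0) else (False, L1)]"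
    using Cons.prems by (auto simp: block_def o_def)
  then show ?case
    using Cons by (simp add: map_replicate_const del: upt_Suc)
qed simp

lemma mu_label_zigzag:
  assumes "is_index ks"
  shows "map (apsnd (mu_label ks ls)) (bpath 1 ls @ apath (sum_list ks)) =
    blocks ls @ map (Pair True) (rev (letters (index_word ks)))"
proof -
  have "map (apsnd (mu_label ks ls)) (apath (sum_list ks)) =
      map (Pair True) (rev (map (\<lambda>t. mu_label ks ls (NA t)) [1..<Suc (sum_list ks)]))"
    by (simp add: apath_def rev_map del: mu_label.simps upt_Suc)
  also have "\<dots> = map (Pair True) (rev (letters (index_word ks)))"
    by (simp only: mu_label_apath[OF assms])
  finally show ?thesis
    using mu_label_bpath[of ls 1 ls ks] by simp
qed


section \<open>The integral-series identity\<close>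

text \<open>At \<open>t = 1\<close> the powers disappear from the polylogarithm series.
  Admissibility makes it summable, so that its real and its extended sum agree.\<close>

lemma ennreal_zeta_index:
  assumes "admissible ks"
  shows "ennreal (zeta_index ks) = iter_int (<) (rev (letters (index_word ks))) 1"
proof (cases ks rule: rev_cases)
  case Nil
  then show ?thesis by (simp add: zeta_index_Nil index_word_def)
next
  case (snoc js j)
  have js: "is_index js" "2 \<le> j" using assms by (simp_all add: snoc admissible_def)
  have "iter_int (<) (rev (letters (index_word ks))) 1 = suminf (\<lambda>n. ennreal (last_sum 0 n ks))"
    using assms iter_int_index_word[of ks 1] by (simp add: admissible_def pser_def)
  also have "\<dots> = ennreal (zeta_index ks)"
    unfolding snoc zeta_index_snoc[OF js]
    by (rule suminf_ennreal2) (simp_all add: last_sum_nonneg summable_last_sum js)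
  finally show ?thesis by (rule sym)
qed

lemma zeta_index_nonneg: "0 \<le> zeta_index ks"
  unfolding zeta_index_def by (intro infsum_nonneg prod_nonneg) simp

lemma mu_eq_sum:
  assumes "is_index ks" "ks \<noteq> []" "is_index ls" "ls \<noteq> []"
  shows "mu ks ls = (\<Sum>xs | extends (mu_nodes ks ls) (mu_relations ks ls) xs.
    Poly_Mapping.single (Word (map (mu_label ks ls) xs)) 1)"
proof -
  have "irrefl (mu_relations ks ls)"
    using assms by (auto simp: irrefl_def mu_relations_def)
  then show ?thesis
    unfolding mu_def poset_word_def mu_order_def prod_list_gen
    by (simp add: linear_extensions_rtrancl mu_relations_nodes[OF assms])
qed

lemma finite_extends: "finite X \<Longrightarrow> finite {xs. extends X r xs}"
  by (rule finite_subset[OF _ finite_subset_distinct[of X]]) (auto simp: extends_def)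

text \<open>Each linear extension contributes one word, whose zeta value is its iterated integral
  once the word is known to be admissible.\<close>

lemma ennreal_zeta_mu:
  assumes "is_index ks" "ks \<noteq> []" "is_index ls" "ls \<noteq> []"
  shows "0 \<le> zeta (mu ks ls)"
    and "ennreal (zeta (mu ks ls)) = (\<Sum>xs | extends (mu_nodes ks ls) (mu_relations ks ls) xs.
      iter_int (<) (rev (map (mu_label ks ls) xs)) 1)"
proof -
  let ?X = "{xs. extends (mu_nodes ks ls) (mu_relations ks ls) xs}"
  let ?w = "\<lambda>xs. Word (map (mu_label ks ls) xs)"
  have fin: "finite ?X" by (rule finite_extends[OF finite_mu_nodes])
  have zeta: "zeta (mu ks ls) = (\<Sum>xs\<in>?X. zeta_index (index_of (?w xs)))"
    by (simp add: mu_eq_sum[OF assms] zeta_sum) (simp add: zeta_def)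
  then show "0 \<le> zeta (mu ks ls)" by (simp add: sum_nonneg zeta_index_nonneg)
  have "ennreal (zeta_index (index_of (?w xs))) = iter_int (<) (rev (map (mu_label ks ls) xs)) 1"
    if xs: "xs \<in> ?X" for xs
  proof -
    \<comment> \<open>Coefficients count linear extensions, so nothing cancels: the word of
      \<open>xs\<close> really occurs in \<open>mu ks ls\<close>, and membership in
      \<open>H0\<close> makes it admissible.\<close>
    have "Poly_Mapping.lookup (mu ks ls) (?w xs) = (\<Sum>ys\<in>?X. 1 when ?w ys = ?w xs)"
      by (simp add: mu_eq_sum[OF assms] lookup_sum lookup_single)
    also have "\<dots> > 0"
      using fin xs by (intro sum_pos2[of _ xs]) (auto simp: when_def)
    finally have "?w xs \<in> Poly_Mapping.keys (mu ks ls)" by (simp add: in_keys_iff)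
    then obtain js where js: "admissible js" "?w xs = index_word js"
      using keys_H0[OF mu_H0[OF assms]] by blast
    have "map (mu_label ks ls) xs = letters (index_word js)"
      by (simp flip: js(2))
    then show ?thesis
      using js ennreal_zeta_index[of js] by (simp add: admissible_def)
  qed
  then show "ennreal (zeta (mu ks ls)) = (\<Sum>xs\<in>?X. iter_int (<) (rev (map (mu_label ks ls) xs)) 1)"
    by (simp add: zeta zeta_index_nonneg flip: sum_ennreal)
qed

theorem theorem4p1:
  fixes ks ls :: "nat list"
  assumes "is_index ks" "ks \<noteq> []"
    and "is_index ls" "ls \<noteq> []"
  shows "zeta (mu ks ls) = zeta (circ_harm (idx ks) (star ls))"
proof -
  let ?p = "bpath 1 ls @ apath (sum_list ks)"
  have "?p \<noteq> []" using assms(4) by (cases ls) auto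
  then obtain d x p where p: "?p = (d, x) # p" by (cases ?p) auto
  have "snd ` set (bpath 1 ls) \<inter> snd ` set (apath (sum_list ks)) = {}"
    using assms(3) by (auto simp: set_bpath set_apath)
  then have dist: "distinct (map snd ?p)"
    using assms(3) by (simp add: distinct_bpath distinct_apath)
  have "ennreal (zeta (mu ks ls)) =
      (\<integral>\<^sup>+t. dens (map (apsnd (mu_label ks ls)) ?p) t \<partial>lborel)"
    using nn_integral_dens[of d x p "mu_label ks ls"] dist
    by (simp only: p ennreal_zeta_mu(2)[OF assms] mu_nodes_eq[OF assms(3)] mu_relations_eq[OF assms])
  also have "\<dots> = suminf (\<lambda>n. ennreal (last_sum 0 n ks * star_sum 1 n ls))"
    unfolding mu_label_zigzag[OF assms(1)] by (rule nn_integral_dens_blocks[OF assms])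
  also have "\<dots> = ennreal (zeta (circ_harm (idx ks) (star ls)))"
    using sums_zeta_circ_harm_star[OF assms]
    by (intro suminf_ennreal_eq) (simp_all add: last_sum_nonneg star_sum_nonneg)
  finally have "ennreal (zeta (mu ks ls)) = ennreal (zeta (circ_harm (idx ks) (star ls)))" .
  \<comment> \<open>\<open>ennreal\<close> sends all negative reals to 0, so signs are needed to
    cancel it.\<close>
  moreover have "0 \<le> zeta (circ_harm (idx ks) (star ls))"
    using sums_le[OF _ sums_zero sums_zeta_circ_harm_star[OF assms]]
    by (simp add: last_sum_nonneg star_sum_nonneg)
  ultimately show ?thesis
    using ennreal_zeta_mu(1)[OF assms] by simp
qed

end
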